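(* Assume that for every $i\in\{1,\dots,L\}$, $\mathbf{K}_i\mathbf{\Sigma}_{\mathbf{s}}\mathbf{K}_i^H\succ 0$ or $\mathbf{\Sigma}_i\succ 0$, and let $\kappa>0$ be a constant. Consider any essentially cyclic $(L+1)$-block coordinate descent algorithm with blocks $\mathbf{F}_1,\dots,\mathbf{F}_L,\mathbf{G}$, in which $\mathbf{G}$ is updated by solving $(\mathsf{P}1)$ and each $\mathbf{F}_i$ is updated by solving $(\mathsf{P}4_i)$ (all defined in the context). Then the generated $\mathsf{MSE}$ sequence is monotonically decreasing (non-increasing), the generated solution sequence has limit points, and each limit point of the solution sequence is a stationary point of the problem $(\mathsf{P}0)$.
   Context: Setting. Positive integers $L,M,K$ and $N_i,J_i$ ($i=1,\dots,L$) are given, together with complex matrices $\mathbf{K}_i\in\mathbb{C}^{J_i\times K}$, $\mathbf{H}_i\in\mathbb{C}^{M\times N_i}$, Hermitian positive semidefinite (covariance) matrices $\mathbf{\Sigma}_{\mathbf{s}}\in\mathbb{C}^{K\times K}$ and $\mathbf{\Sigma}_i\in\mathbb{C}^{J_i\times J_i}$, and reals $\sigma_0^2>0$, $P_i>0$. For $\mathbf{F}_i\in\mathbb{C}^{N_i\times J_i}$ and $\mathbf{G}\in\mathbb{C}^{M\times K}$ put $\mathbf{S}=\sum_{i=1}^L\mathbf{H}_i\mathbf{F}_i\mathbf{K}_i$ and $$\mathsf{MSE}\big(\{\mathbf{F}_i\}_{i=1}^L,\mathbf{G}\big)=\mathrm{Tr}\Big\{\mathbf{G}^H\mathbf{S}\mathbf{\Sigma}_{\mathbf{s}}\mathbf{S}^H\mathbf{G}-\mathbf{G}^H\mathbf{S}\mathbf{\Sigma}_{\mathbf{s}}-\mathbf{\Sigma}_{\mathbf{s}}\mathbf{S}^H\mathbf{G}+\sum_{i=1}^L\mathbf{G}^H\mathbf{H}_i\mathbf{F}_i\mathbf{\Sigma}_i\mathbf{F}_i^H\mathbf{H}_i^H\mathbf{G}+\sigma_0^2\mathbf{G}^H\mathbf{G}+\mathbf{\Sigma}_{\mathbf{s}}\Big\}.$$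 Problem $(\mathsf{P}0)$: minimize $\mathsf{MSE}\big(\{\mathbf{F}_i\}_{i=1}^L,\mathbf{G}\big)$ over all $\mathbf{F}_i\in\mathbb{C}^{N_i\times J_i}$, $\mathbf{G}\in\mathbb{C}^{M\times K}$ subject to $\mathrm{Tr}\{\mathbf{F}_i(\mathbf{K}_i\mathbf{\Sigma}_{\mathbf{s}}\mathbf{K}_i^H+\mathbf{\Sigma}_i)\mathbf{F}_i^H\}\le P_i$ for $i=1,\dots,L$. Block updates. $(\mathsf{P}1)$: with all $\mathbf{F}_i$ fixed at their current values, replace $\mathbf{G}$ by the (unique) minimizer of $\mathsf{MSE}$ over $\mathbf{G}\in\mathbb{C}^{M\times K}$, namely $\big[\mathbf{S}\mathbf{\Sigma}_{\mathbf{s}}\mathbf{S}^H+\sigma_0^2\mathbf{I}_M+\sum_{i}\mathbf{H}_i\mathbf{F}_i\mathbf{\Sigma}_i\mathbf{F}_i^H\mathbf{H}_i^H\big]^{-1}\mathbf{S}\mathbf{\Sigma}_{\mathbf{s}}$. $(\mathsf{P}4_i)$: with $\mathbf{G}$ and $\{\mathbf{F}_j\}_{j\ne i}$ fixed at their current values, and with $\hat{\mathbf{F}}_i$ denoting the current (latest) value of $\mathbf{F}_i$, replace $\mathbf{F}_i$ by the minimizer of the proximal objective $$\mathsf{MSE}\big(\{\mathbf{F}_j\}_{j=1}^L,\mathbf{G}\big)+\kappa\,\|\mathrm{vec}(\mathbf{F}_i)-\mathrm{vec}(\hat{\mathbf{F}}_i)\|_2^2$$ over $\mathbf{F}_i\in\mathbb{C}^{N_i\times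 J_i}$ subject to $\mathrm{Tr}\{\mathbf{F}_i(\mathbf{K}_i\mathbf{\Sigma}_{\mathbf{s}}\mathbf{K}_i^H+\mathbf{\Sigma}_i)\mathbf{F}_i^H\}\le P_i$. Algorithm. Start from any point feasible for $(\mathsf{P}0)$; at each iteration exactly one of the $L+1$ blocks is updated and the iteration index increases by one; the algorithm runs indefinitely. The solution sequence and $\mathsf{MSE}$ sequence consist of the points, respectively the values of $\mathsf{MSE}$, after each block update. The update rule is essentially cyclic: there is a positive integer $T$ such that every block is updated at least once within any $T$ consecutive updates. Stationary point. For a problem $\min\{f(\mathbf{x})\mid\mathbf{x}\in\mathcal{X}\}$ with $f$ continuously differentiable and $\mathcal{X}$ closed and nonempty, $\mathbf{x}_0\in\mathcal{X}$ is a stationary point iff $\nabla f(\mathbf{x}_0)(\mathbf{x}-\mathbf{x}_0)\ge 0$ for all $\mathbf{x}\in\mathcal{X}$; complex variables are identified with their real and imaginary parts, so this says the (real) directional derivative of $f$ at $\mathbf{x}_0$ in direction $\mathbf{x}-\mathbf{x}_0$ is nonnegative. A limit point of a sequence is the limit of some convergent subsequence. $\mathbf{X}\succ 0$ means Hermitian positive definite. *)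

theory Defs
  imports Complex_Main "Jordan_Normal_Form.Schur_Decomposition"
begin

notation mat_adjoint ("(_\<^sup>H)" [1000] 999)

definition trace :: "complex mat \<Rightarrow> complex" where
  "trace A = (\<Sum>i<dim_row A. A $$ (i, i))"

definition mat_sum :: "nat \<Rightarrow> nat \<Rightarrow> (nat \<Rightarrow> complex mat) \<Rightarrow> nat set \<Rightarrow> complex mat" where
  "mat_sum nr nc A I = mat nr nc (\<lambda>(a, b). \<Sum>i\<in>I. A i $$ (a, b))"

text \<open>Below, \<open>(A *\<^sub>v v) \<bullet>c v\<close> is \<open>v\<^sup>H A v\<close>; the order on the complex numbers is the one
  in which \<open>0 \<le> z\<close> says that \<open>z\<close> is real and nonnegative.\<close>

definition hermitian :: "nat \<Rightarrow> complex mat \<Rightarrow> bool" where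
  "hermitian n A \<longleftrightarrow> A \<in> carrier_mat n n \<and> A\<^sup>H = A"

definition pos_semidef :: "nat \<Rightarrow> complex mat \<Rightarrow> bool" where
  "pos_semidef n A \<longleftrightarrow> hermitian n A \<and> (\<forall>v\<in>carrier_vec n. 0 \<le> (A *\<^sub>v v) \<bullet>c v)"

definition pos_def :: "nat \<Rightarrow> complex mat \<Rightarrow> bool" where
  "pos_def n A \<longleftrightarrow> hermitian n A \<and> (\<forall>v\<in>carrier_vec n. v \<noteq> 0\<^sub>v n \<longrightarrow> 0 < (A *\<^sub>v v) \<bullet>c v)"

text \<open>Column stacking.\<close>

definition vectorize :: "complex mat \<Rightarrow> complex vec" where
  "vectorize A = vec (dim_row A * dim_col A) (\<lambda>k. A $$ (k mod dim_row A, k div dim_row A))"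

definition vec_norm2 :: "complex vec \<Rightarrow> real" where
  "vec_norm2 v = sqrt (\<Sum>k<dim_vec v. (cmod (v $ k))\<^sup>2)"

text \<open>The data of the problem: \<open>obs i\<close>, \<open>chan i\<close>, \<open>cov_src\<close>, \<open>cov_obs i\<close>, \<open>noise_var\<close>, \<open>power i\<close>
  are \<open>K\<^sub>i\<close>, \<open>H\<^sub>i\<close>, \<open>\<Sigma>\<^sub>s\<close>, \<open>\<Sigma>\<^sub>i\<close>, \<open>\<sigma>\<^sub>0\<^sup>2\<close>, \<open>P\<^sub>i\<close>. Families indexed by \<open>i\<close> are only meaningful
  for \<open>i \<in> {1..L}\<close>.\<close>

record mse_system =
  num_sensors :: nat
  dim_M :: nat
  dim_K :: nat
  dim_N :: "nat \<Rightarrow> nat"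
  dim_J :: "nat \<Rightarrow> nat"
  obs :: "nat \<Rightarrow> complex mat"
  chan :: "nat \<Rightarrow> complex mat"
  cov_src :: "complex mat"
  cov_obs :: "nat \<Rightarrow> complex mat"
  noise_var :: real
  power :: "nat \<Rightarrow> real"

definition sensors :: "mse_system \<Rightarrow> nat set" where
  "sensors p = {1..num_sensors p}"

definition valid_system :: "mse_system \<Rightarrow> bool" where
  "valid_system p \<longleftrightarrow>
     0 < num_sensors p \<and> 0 < dim_M p \<and> 0 < dim_K p \<and> 0 < noise_var p \<and>
     pos_semidef (dim_K p) (cov_src p) \<and>
     (\<forall>i\<in>sensors p.
        0 < dim_N p i \<and> 0 < dim_J p i \<and> 0 < power p i \<and>
        obs p i \<in> carrier_mat (dim_J p i) (dim_K p) \<and>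
        chan p i \<in> carrier_mat (dim_M p) (dim_N p i) \<and>
        pos_semidef (dim_J p i) (cov_obs p i))"

definition signal_mat :: "mse_system \<Rightarrow> (nat \<Rightarrow> complex mat) \<Rightarrow> complex mat" where
  "signal_mat p F = mat_sum (dim_M p) (dim_K p) (\<lambda>i. chan p i * F i * obs p i) (sensors p)"

text \<open>The traces in \<open>MSE\<close> and in the power constraint are traces of Hermitian matrices, hence
  real; \<open>Re\<close> only changes the type.\<close>

definition MSE :: "mse_system \<Rightarrow> (nat \<Rightarrow> complex mat) \<Rightarrow> complex mat \<Rightarrow> real" where
  "MSE p F G =
     (let S = signal_mat p F; C = cov_src p in
      Re (trace (G\<^sup>H * S * C * S\<^sup>H * G - G\<^sup>H * S * C - C * S\<^sup>H * G
        + mat_sum (dim_K p) (dim_K p)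
            (\<lambda>i. G\<^sup>H * chan p i * F i * cov_obs p i * (F i)\<^sup>H * (chan p i)\<^sup>H * G) (sensors p)
        + complex_of_real (noise_var p) \<cdot>\<^sub>m (G\<^sup>H * G)
        + C)))"

definition feasible_F :: "mse_system \<Rightarrow> nat \<Rightarrow> complex mat \<Rightarrow> bool" where
  "feasible_F p i X \<longleftrightarrow>
     X \<in> carrier_mat (dim_N p i) (dim_J p i) \<and>
     Re (trace (X * (obs p i * cov_src p * (obs p i)\<^sup>H + cov_obs p i) * X\<^sup>H)) \<le> power p i"

definition feasible :: "mse_system \<Rightarrow> (nat \<Rightarrow> complex mat) \<Rightarrow> complex mat \<Rightarrow> bool" where
  "feasible p F G \<longleftrightarrow> (\<forall>i\<in>sensors p. feasible_F p i (F i)) \<and> G \<in> carrier_mat (dim_M p) (dim_K p)"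

text \<open>The gradient of \<open>MSE\<close> at \<open>(F, G)\<close> applied to \<open>(F', G') - (F, G)\<close> is the real derivative of
  \<open>MSE\<close> along the segment from \<open>(F, G)\<close> to \<open>(F', G')\<close>.\<close>

definition stationary_point :: "mse_system \<Rightarrow> (nat \<Rightarrow> complex mat) \<Rightarrow> complex mat \<Rightarrow> bool" where
  "stationary_point p F G \<longleftrightarrow> feasible p F G \<and>
     (\<forall>F' G'. feasible p F' G' \<longrightarrow>
        (\<exists>D\<ge>0. ((\<lambda>t. MSE p (\<lambda>i. F i + complex_of_real t \<cdot>\<^sub>m (F' i - F i))
                           (G + complex_of_real t \<cdot>\<^sub>m (G' - G))) has_real_derivative D) (at 0)))"

datatype block = F_block nat | G_block

definition blocks :: "mse_system \<Rightarrow> block set" where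
  "blocks p = insert G_block (F_block ` sensors p)"

definition essentially_cyclic :: "mse_system \<Rightarrow> (nat \<Rightarrow> block) \<Rightarrow> bool" where
  "essentially_cyclic p u \<longleftrightarrow> (\<forall>n. u n \<in> blocks p) \<and>
     (\<exists>T>0. \<forall>n. \<forall>b\<in>blocks p. \<exists>m\<in>{n..<n + T}. u m = b)"

definition proximal_objective ::
    "mse_system \<Rightarrow> real \<Rightarrow> (nat \<Rightarrow> complex mat) \<Rightarrow> complex mat \<Rightarrow> nat \<Rightarrow> complex mat \<Rightarrow> real" where
  "proximal_objective p \<kappa> F G i X =
     MSE p (F(i := X)) G + \<kappa> * (vec_norm2 (vectorize X - vectorize (F i)))\<^sup>2"

fun block_update :: "mse_system \<Rightarrow> real \<Rightarrow> block \<Rightarrow> (nat \<Rightarrow> complex mat) \<Rightarrow> complex mat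
    \<Rightarrow> (nat \<Rightarrow> complex mat) \<Rightarrow> complex mat \<Rightarrow> bool" where
  "block_update p \<kappa> G_block F G F' G' \<longleftrightarrow>
     (\<forall>j\<in>sensors p. F' j = F j) \<and>
     is_arg_min (MSE p F) (\<lambda>X. X \<in> carrier_mat (dim_M p) (dim_K p)) G'"
| "block_update p \<kappa> (F_block i) F G F' G' \<longleftrightarrow>
     G' = G \<and> (\<forall>j\<in>sensors p - {i}. F' j = F j) \<and>
     is_arg_min (proximal_objective p \<kappa> F G i) (feasible_F p i) (F' i)"

text \<open>\<open>(F n, G n)\<close> is the point after \<open>n\<close> block updates, and \<open>u n\<close> is the block changed by the
  update leading from it to \<open>(F (Suc n), G (Suc n))\<close>.\<close>

definition bcd_run :: "mse_system \<Rightarrow> real \<Rightarrow> (nat \<Rightarrow> block)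
    \<Rightarrow> (nat \<Rightarrow> nat \<Rightarrow> complex mat) \<Rightarrow> (nat \<Rightarrow> complex mat) \<Rightarrow> bool" where
  "bcd_run p \<kappa> u F G \<longleftrightarrow> feasible p (F 0) (G 0) \<and>
     (\<forall>n. block_update p \<kappa> (u n) (F n) (G n) (F (Suc n)) (G (Suc n)))"

definition mat_tendsto :: "nat \<Rightarrow> nat \<Rightarrow> (nat \<Rightarrow> complex mat) \<Rightarrow> complex mat \<Rightarrow> bool" where
  "mat_tendsto nr nc X A \<longleftrightarrow> A \<in> carrier_mat nr nc \<and>
     (\<forall>a<nr. \<forall>b<nc. (\<lambda>n. X n $$ (a, b)) \<longlonglongrightarrow> A $$ (a, b))"

definition limit_point :: "mse_system \<Rightarrow> (nat \<Rightarrow> nat \<Rightarrow> complex mat) \<Rightarrow> (nat \<Rightarrow> complex mat)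
    \<Rightarrow> (nat \<Rightarrow> complex mat) \<Rightarrow> complex mat \<Rightarrow> bool" where
  "limit_point p F G F' G' \<longleftrightarrow> (\<exists>r. strict_mono r \<and>
     (\<forall>i\<in>sensors p. mat_tendsto (dim_N p i) (dim_J p i) (\<lambda>n. F (r n) i) (F' i)) \<and>
     mat_tendsto (dim_M p) (dim_K p) (\<lambda>n. G (r n)) G')"

end

theory Submission
  imports Defs
begin

text \<open>Completing the square, \<open>MSE = Tr (W \<Sigma>\<^sub>s W\<^sup>H) + \<Sum>\<^sub>i Tr (N\<^sub>i \<Sigma>\<^sub>i N\<^sub>i\<^sup>H) + \<sigma>\<^sub>0\<^sup>2 Tr (G\<^sup>H G)\<close> with
  \<open>W = G\<^sup>H S - I\<close> and \<open>N\<^sub>i = G\<^sup>H H\<^sub>i F\<^sub>i\<close>. So \<open>MSE\<close> is nonnegative, controls the norm of \<open>G\<close>, and is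
  strongly convex in \<open>G\<close>; together with the proximal term, every block update that moves the point
  by \<open>\<delta>\<close> lowers \<open>MSE\<close> by at least a constant times \<open>\<delta>\<^sup>2\<close>. Hence the steps tend to zero. The power
  constraints bound the \<open>F\<^sub>i\<close> by definiteness, so limit points exist. Near a limit point each block
  is updated within \<open>T\<close> steps, at points that tend to the same limit, so the optimality of each block
  update passes to the limit: the limit minimizes the proximal objective in every single block. Since
  the proximal term has zero derivative there and the feasible set is a convex product, the
  directional derivatives along the blocks are nonnegative, and they add up to the full one.\<close>

section \<open>Real polynomial functions of finitely many complex coordinates\<close>

text \<open>Polynomials in the coordinates from \<open>V\<close> and their conjugates. Rule
  induction shows that they depend on these coordinates alone and gives continuity under
  coordinatewise convergence as well as differentiability along lines.\<close>

inductive cpoly :: "'v set \<Rightarrow> (('v \<Rightarrow> complex) \<Rightarrow> complex) \<Rightarrow> bool" for V where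
  cpoly_const: "cpoly V (\<lambda>x. c)"
| cpoly_var: "v \<in> V \<Longrightarrow> cpoly V (\<lambda>x. x v)"
| cpoly_cnj: "cpoly V f \<Longrightarrow> cpoly V (\<lambda>x. cnj (f x))"
| cpoly_add: "cpoly V f \<Longrightarrow> cpoly V g \<Longrightarrow> cpoly V (\<lambda>x. f x + g x)"
| cpoly_mult: "cpoly V f \<Longrightarrow> cpoly V g \<Longrightarrow> cpoly V (\<lambda>x. f x * g x)"

lemma cpoly_diff:
  assumes "cpoly V f" "cpoly V g"
  shows "cpoly V (\<lambda>x. f x - g x)"
  using cpoly_add[OF assms(1) cpoly_mult[OF cpoly_const[of V "-1"] assms(2)]] by simp

lemma cpoly_sum: "(\<And>i. i \<in> I \<Longrightarrow> cpoly V (f i)) \<Longrightarrow> cpoly V (\<lambda>x. \<Sum>i\<in>I. f i x)"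
proof (induction I rule: infinite_finite_induct)
  case (insert i I)
  then show ?case using cpoly_add[of V "f i" "\<lambda>x. \<Sum>i\<in>I. f i x"] by simp
qed (simp_all add: cpoly_const)

lemmas cpoly_intros = cpoly_const cpoly_var cpoly_cnj cpoly_add cpoly_mult cpoly_diff cpoly_sum

lemma cpoly_cong:
  assumes "cpoly V f" "\<And>v. v \<in> V \<Longrightarrow> x v = y v"
  shows "f x = f y"
  using assms by induction auto

lemma cpoly_tendsto:
  assumes "cpoly V f" "\<And>v. v \<in> V \<Longrightarrow> (\<lambda>n. x n v) \<longlonglongrightarrow> y v"
  shows "(\<lambda>n. f (x n)) \<longlonglongrightarrow> f y"
  using assms by induction (auto intro!: tendsto_intros)

text \<open>Sum and product rule, by induction. One map \<open>D\<close> serves all directions, and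
  its additivity is what later lets derivatives along single blocks add up to the derivative along
  an arbitrary direction.\<close>

lemma cpoly_derivative:
  assumes "cpoly V f"
  shows "\<exists>D. (\<forall>d. ((\<lambda>t. f (\<lambda>v. x v + complex_of_real t * d v)) has_vector_derivative D d) (at 0))
    \<and> (\<forall>d e. D (\<lambda>v. d v + e v) = D d + D e)"
  using assms
proof induction
  case (cpoly_const c)
  show ?case by (rule exI[of _ "\<lambda>_. 0"]) auto
next
  case (cpoly_var v)
  show ?case
    by (rule exI[of _ "\<lambda>d. d v"])
       (auto simp: has_vector_derivative_def scaleR_conv_of_real intro!: derivative_eq_intros)
next
  case (cpoly_cnj f)
  then obtain D where D: "\<And>d. ((\<lambda>t. f (\<lambda>v. x v + complex_of_real t * d v)) has_vector_derivative D d) (at 0)"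
    "\<And>d e. D (\<lambda>v. d v + e v) = D d + D e" by blast
  show ?case
    by (rule exI[of _ "\<lambda>d. cnj (D d)"]) (auto simp: D(2) intro!: has_vector_derivative_cnj D(1))
next
  case (cpoly_add f g)
  then obtain D E where D: "\<And>d. ((\<lambda>t. f (\<lambda>v. x v + complex_of_real t * d v)) has_vector_derivative D d) (at 0)"
    "\<And>d e. D (\<lambda>v. d v + e v) = D d + D e"
    and E: "\<And>d. ((\<lambda>t. g (\<lambda>v. x v + complex_of_real t * d v)) has_vector_derivative E d) (at 0)"
    "\<And>d e. E (\<lambda>v. d v + e v) = E d + E e" by blast
  show ?case
    by (rule exI[of _ "\<lambda>d. D d + E d"])
       (auto simp: D(2) E(2) intro!: has_vector_derivative_add D(1) E(1))
next
  case (cpoly_mult f g)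
  then obtain D E where D: "\<And>d. ((\<lambda>t. f (\<lambda>v. x v + complex_of_real t * d v)) has_vector_derivative D d) (at 0)"
    "\<And>d e. D (\<lambda>v. d v + e v) = D d + D e"
    and E: "\<And>d. ((\<lambda>t. g (\<lambda>v. x v + complex_of_real t * d v)) has_vector_derivative E d) (at 0)"
    "\<And>d e. E (\<lambda>v. d v + e v) = E d + E e" by blast
  have "((\<lambda>t. f (\<lambda>v. x v + complex_of_real t * d v) * g (\<lambda>v. x v + complex_of_real t * d v))
      has_vector_derivative f x * E d + D d * g x) (at 0)" for d
    using has_derivative_mult[OF D(1)[unfolded has_vector_derivative_def] E(1)[unfolded has_vector_derivative_def], of d d]
    by (simp add: has_vector_derivative_def algebra_simps)
  then show ?case
    by (intro exI[of _ "\<lambda>d. f x * E d + D d * g x"]) (auto simp: D(2) E(2) algebra_simps)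
qed

section \<open>Compactness in finitely many coordinates\<close>

text \<open>Every real sequence has a monotone subsequence, and a bounded monotone sequence
  converges.\<close>

lemma bounded_real_subseq:
  fixes X :: "nat \<Rightarrow> real"
  assumes "\<And>n. \<bar>X n\<bar> \<le> B"
  shows "\<exists>r l. strict_mono (r :: nat \<Rightarrow> nat) \<and> (\<lambda>n. X (r n)) \<longlonglongrightarrow> l"
proof -
  obtain r :: "nat \<Rightarrow> nat" where r: "strict_mono r" "monoseq (\<lambda>n. X (r n))"
    using seq_monosub[of X] by auto
  have "Bseq (\<lambda>n. X (r n))"
    using assms by (auto intro!: BseqI'[where K = B])
  then have "convergent (\<lambda>n. X (r n))"
    using r(2) by (rule Bseq_monoseq_convergent)
  then show ?thesis
    using r(1) by (auto simp: convergent_def)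
qed

lemma bounded_complex_subseq:
  fixes X :: "nat \<Rightarrow> complex"
  assumes "\<And>n. cmod (X n) \<le> B"
  shows "\<exists>r l. strict_mono (r :: nat \<Rightarrow> nat) \<and> (\<lambda>n. X (r n)) \<longlonglongrightarrow> l"
proof -
  have "\<bar>Re (X n)\<bar> \<le> B" for n
    using assms[of n] abs_Re_le_cmod[of "X n"] by linarith
  then obtain r a where r: "strict_mono (r :: nat \<Rightarrow> nat)" "(\<lambda>n. Re (X (r n))) \<longlonglongrightarrow> a"
    using bounded_real_subseq[of "\<lambda>n. Re (X n)" B] by blast
  have "\<bar>Im (X (r n))\<bar> \<le> B" for n
    using assms[of "r n"] abs_Im_le_cmod[of "X (r n)"] by linarith
  then obtain s b where s: "strict_mono (s :: nat \<Rightarrow> nat)" "(\<lambda>n. Im (X (r (s n)))) \<longlonglongrightarrow> b"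
    using bounded_real_subseq[of "\<lambda>n. Im (X (r n))"] by blast
  have "(\<lambda>n. Re (X (r (s n)))) \<longlonglongrightarrow> a"
    using LIMSEQ_subseq_LIMSEQ[OF r(2) s(1)] by (simp add: o_def)
  then have "(\<lambda>n. X (r (s n))) \<longlonglongrightarrow> Complex a b"
    using s(2) by (simp add: tendsto_complex_iff)
  moreover have "strict_mono (\<lambda>n. r (s n))"
    using strict_mono_o[OF r(1) s(1)] by (simp add: o_def)
  ultimately show ?thesis by blast
qed

text \<open>Each coordinate costs one further extraction, which preserves the limits already
  obtained.\<close>

lemma bounded_coordinates_subseq:
  fixes X :: "nat \<Rightarrow> 'v \<Rightarrow> complex"
  assumes "finite V" "\<And>v n. v \<in> V \<Longrightarrow> cmod (X n v) \<le> B v"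
  shows "\<exists>r l. strict_mono (r :: nat \<Rightarrow> nat) \<and> (\<forall>v\<in>V. (\<lambda>n. X (r n) v) \<longlonglongrightarrow> l v)"
  using assms
proof (induction V rule: finite_induct)
  case empty
  show ?case by (intro exI[of _ "\<lambda>n. n"]) (auto simp: strict_mono_def)
next
  case (insert w V)
  then obtain r l where r: "strict_mono (r :: nat \<Rightarrow> nat)" "\<And>v. v \<in> V \<Longrightarrow> (\<lambda>n. X (r n) v) \<longlonglongrightarrow> l v"
    by (metis insertI2)
  obtain s a where s: "strict_mono (s :: nat \<Rightarrow> nat)" "(\<lambda>n. X (r (s n)) w) \<longlonglongrightarrow> a"
    using bounded_complex_subseq[of "\<lambda>n. X (r n) w"] insert.prems by blast
  have "(\<lambda>n. X (r (s n)) v) \<longlonglongrightarrow> (l(w := a)) v" if "v \<in> insert w V" for v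
    using that s(2) LIMSEQ_subseq_LIMSEQ[OF r(2) s(1)] by (auto simp: o_def)
  moreover have "strict_mono (\<lambda>n. r (s n))"
    using strict_mono_o[OF r(1) s(1)] by (simp add: o_def)
  ultimately show ?case by blast
qed

section \<open>Block coordinate descent\<close>

text \<open>Points are total functions whose values outside \<open>V\<close> are arbitrary, so the
  distance looks at \<open>V\<close> only.\<close>

definition sqdist :: "'v set \<Rightarrow> ('v \<Rightarrow> complex) \<Rightarrow> ('v \<Rightarrow> complex) \<Rightarrow> real" where
  "sqdist V x y = (\<Sum>v\<in>V. (cmod (x v - y v))\<^sup>2)"

lemma sqdist_tendsto:
  assumes "\<And>v. v \<in> V \<Longrightarrow> (\<lambda>n. x n v) \<longlonglongrightarrow> a v" "\<And>v. v \<in> V \<Longrightarrow> (\<lambda>n. y n v) \<longlonglongrightarrow> b v"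
  shows "(\<lambda>n. sqdist V (x n) (y n)) \<longlonglongrightarrow> sqdist V a b"
  unfolding sqdist_def using assms by (auto intro!: tendsto_intros)

text \<open>The convergence argument freed from matrices: \<open>blk v\<close> is the block of
  coordinate \<open>v\<close>, and \<open>X b\<close> is the constraint on block \<open>b\<close>.
  The form of \<open>optimal\<close> covers updates with and without a proximal term: in the first
  case the term of the new point is dropped on the left, in the second a nonnegative term is added
  on the right.\<close>

locale block_descent =
  fixes V :: "'v set" and blk :: "'v \<Rightarrow> 'b" and B :: "'b set"
    and f :: "('v \<Rightarrow> complex) \<Rightarrow> complex" and X :: "'b \<Rightarrow> ('v \<Rightarrow> complex) \<Rightarrow> bool"
    and \<kappa> c :: real and u :: "nat \<Rightarrow> 'b" and x :: "nat \<Rightarrow> 'v \<Rightarrow> complex" and T :: nat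
  assumes finite_V: "finite V" and finite_B: "finite B" and blk: "blk ` V \<subseteq> B"
    and poly: "cpoly V f" and nonneg: "\<And>n. 0 \<le> Re (f (x n))" and c: "0 < c"
    and closed: "\<And>b y z. b \<in> B \<Longrightarrow> (\<And>n. X b (y n)) \<Longrightarrow>
      (\<And>v. v \<in> V \<Longrightarrow> blk v = b \<Longrightarrow> (\<lambda>n. y n v) \<longlonglongrightarrow> z v) \<Longrightarrow> X b z"
    and convex: "\<And>b y z t. b \<in> B \<Longrightarrow> X b y \<Longrightarrow> X b z \<Longrightarrow> 0 \<le> t \<Longrightarrow> t \<le> 1 \<Longrightarrow>
      X b (\<lambda>v. y v + complex_of_real t * (z v - y v))"
    and feasible: "\<And>n b. b \<in> B \<Longrightarrow> X b (x n)"
    and cyclic: "\<And>n b. b \<in> B \<Longrightarrow> \<exists>m. n \<le> m \<and> m < n + T \<and> u m = b"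
    and descent: "\<And>n. Re (f (x (Suc n))) + c * sqdist V (x (Suc n)) (x n) \<le> Re (f (x n))"
    and optimal: "\<And>n y. X (u n) y \<Longrightarrow> (\<And>v. v \<in> V \<Longrightarrow> blk v \<noteq> u n \<Longrightarrow> y v = x n v) \<Longrightarrow>
      Re (f (x (Suc n))) \<le> Re (f y) + \<kappa> * sqdist V y (x n)"
    and bounded: "\<And>v. v \<in> V \<Longrightarrow> \<exists>R. \<forall>n. cmod (x n v) \<le> R"
begin

lemma decseq_values: "decseq (\<lambda>n. Re (f (x n)))"
proof (rule decseq_SucI)
  fix n
  have "0 \<le> c * sqdist V (x (Suc n)) (x n)"
    using c by (auto simp: sqdist_def intro!: mult_nonneg_nonneg sum_nonneg)
  then show "Re (f (x (Suc n))) \<le> Re (f (x n))"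
    using descent[of n] by linarith
qed

text \<open>By \<open>descent\<close> the squared step is at most the decrease of the value divided
  by \<open>c\<close>, and the values converge, being monotone and bounded below.\<close>

lemma step_vanishes:
  assumes v: "v \<in> V"
  shows "(\<lambda>n. x (Suc n) v - x n v) \<longlonglongrightarrow> 0"
proof -
  obtain l where l: "(\<lambda>n. Re (f (x n))) \<longlonglongrightarrow> l"
    using decseq_convergent[OF decseq_values] nonneg by metis
  have "(\<lambda>n. (Re (f (x n)) - Re (f (x (Suc n)))) / c) \<longlonglongrightarrow> (l - l) / c"
    using l c by (intro tendsto_intros) (auto dest: LIMSEQ_Suc)
  then have lim: "(\<lambda>n. (Re (f (x n)) - Re (f (x (Suc n)))) / c) \<longlonglongrightarrow> 0" by simp
  have "(\<lambda>n. (cmod (x (Suc n) v - x n v))\<^sup>2) \<longlonglongrightarrow> 0"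
  proof (rule tendsto_sandwich[OF _ _ tendsto_const lim])
    show "\<forall>\<^sub>F n in sequentially. (cmod (x (Suc n) v - x n v))\<^sup>2 \<le> (Re (f (x n)) - Re (f (x (Suc n)))) / c"
    proof (rule always_eventually, rule allI)
      fix n
      have "(cmod (x (Suc n) v - x n v))\<^sup>2 \<le> sqdist V (x (Suc n)) (x n)"
        unfolding sqdist_def using v finite_V by (intro member_le_sum) auto
      also have "\<dots> \<le> (Re (f (x n)) - Re (f (x (Suc n)))) / c"
        using descent[of n] c by (simp add: field_simps)
      finally show "(cmod (x (Suc n) v - x n v))\<^sup>2 \<le> \<dots>" .
    qed
  qed auto
  then have "(\<lambda>n. sqrt ((cmod (x (Suc n) v - x n v))\<^sup>2)) \<longlonglongrightarrow> sqrt 0"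
    by (intro tendsto_intros)
  then show ?thesis by (simp add: tendsto_norm_zero_iff)
qed

text \<open>Boundedly many vanishing steps do not change a limit; this is where essential cyclicity
  will enter.\<close>

lemma nearby_tendsto:
  assumes v: "v \<in> V" and lim: "(\<lambda>n. x (r n) v) \<longlonglongrightarrow> a" and r: "strict_mono r"
    and m: "\<And>n. r n \<le> m n" "\<And>n. m n < r n + S"
  shows "(\<lambda>n. x (m n) v) \<longlonglongrightarrow> a"
proof -
  have off: "(\<lambda>n. x (n + j) v - x n v) \<longlonglongrightarrow> 0" for j
  proof (induction j)
    case (Suc j)
    have "(\<lambda>n. x (Suc (n + j)) v - x (n + j) v) \<longlonglongrightarrow> 0"
      using LIMSEQ_ignore_initial_segment[OF step_vanishes[OF v], of j] by simp
    from tendsto_add[OF this Suc] show ?case by simp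
  qed simp
  \<comment> \<open>The offset \<open>m n - r n\<close> varies with \<open>n\<close> but stays below
    \<open>S\<close>, so the sum over all these offsets dominates the one that occurs.\<close>
  define e where "e n = (\<Sum>j<S. cmod (x (n + j) v - x n v))" for n
  have "e \<longlonglongrightarrow> (\<Sum>j<S. 0)"
    unfolding e_def by (intro tendsto_sum tendsto_norm_zero off)
  then have e: "(\<lambda>n. e (r n)) \<longlonglongrightarrow> 0"
    using LIMSEQ_subseq_LIMSEQ[of e 0 r] r by (simp add: o_def)
  have "cmod (x (m n) v - x (r n) v) \<le> e (r n)" for n
  proof -
    have "cmod (x (r n + (m n - r n)) v - x (r n) v) \<le> e (r n)"
      unfolding e_def using m[of n]
      by (intro member_le_sum[of "m n - r n" _ "\<lambda>j. cmod (x (r n + j) v - x (r n) v)"]) auto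
    then show ?thesis using m(1)[of n] by simp
  qed
  then have "(\<lambda>n. x (m n) v - x (r n) v) \<longlonglongrightarrow> 0"
    by (intro tendsto_0_le[OF e, of _ 1] always_eventually) (auto intro: order_trans[OF _ abs_ge_self])
  from tendsto_add[OF this lim] show ?thesis by simp
qed

text \<open>The index is shifted because the solution sequence begins with the point after the first
  update.\<close>

lemma limit_exists: "\<exists>r l. strict_mono (r :: nat \<Rightarrow> nat) \<and> (\<forall>v\<in>V. (\<lambda>n. x (Suc (r n)) v) \<longlonglongrightarrow> l v)"
proof -
  obtain R where "\<And>v n. v \<in> V \<Longrightarrow> cmod (x n v) \<le> R v"
    using bounded by metis
  then show ?thesis
    using bounded_coordinates_subseq[OF finite_V, of "\<lambda>n. x (Suc n)" R] by blast
qed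

text \<open>Closedness applied to a constant sequence: the constraint on block \<open>b\<close> sees
  only the coordinates of that block.\<close>

lemma cong_X: "b \<in> B \<Longrightarrow> X b y \<Longrightarrow> (\<And>v. v \<in> V \<Longrightarrow> blk v = b \<Longrightarrow> y v = z v) \<Longrightarrow> X b z"
  using closed[of b "\<lambda>_. y" z] by simp

section \<open>Limit points of the iterates\<close>

context
  fixes r :: "nat \<Rightarrow> nat" and z :: "'v \<Rightarrow> complex"
  assumes r: "strict_mono r" and z: "\<And>v. v \<in> V \<Longrightarrow> (\<lambda>n. x (r n) v) \<longlonglongrightarrow> z v"
begin

lemma limit_feasible: "b \<in> B \<Longrightarrow> X b z"
  using closed[of b "\<lambda>n. x (r n)" z] feasible z by blast

text \<open>Block \<open>b\<close> is updated at some time \<open>m n\<close> within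
  \<open>T\<close> steps after \<open>r n\<close>. The points before and after that update tend to
  \<open>z\<close> too, so the optimality of the update passes to the limit.\<close>

lemma limit_block_optimal:
  assumes b: "b \<in> B" and y: "X b y" "\<And>v. v \<in> V \<Longrightarrow> blk v \<noteq> b \<Longrightarrow> y v = z v"
  shows "Re (f z) \<le> Re (f y) + \<kappa> * sqdist V y z"
proof -
  obtain m where m: "\<And>n. r n \<le> m n" "\<And>n. m n < r n + T" "\<And>n. u (m n) = b"
    using choice[of "\<lambda>n m. r n \<le> m \<and> m < r n + T \<and> u m = b"] cyclic[OF b] by blast
  have xm: "(\<lambda>n. x (m n) v) \<longlonglongrightarrow> z v" if "v \<in> V" for v
    using nearby_tendsto[OF that z[OF that] r m(1,2)] .
  \<comment> \<open>The point after the update may lie \<open>T\<close> steps beyond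
    \<open>r n\<close>, hence the window \<open>Suc T\<close>.\<close>
  have xSm: "(\<lambda>n. x (Suc (m n)) v) \<longlonglongrightarrow> z v" if "v \<in> V" for v
    using m by (intro nearby_tendsto[OF that z[OF that] r, of "\<lambda>n. Suc (m n)" "Suc T"])
      (auto intro: le_SucI)
  \<comment> \<open>The competitor \<open>y\<close> need not agree with the iterate off block
    \<open>b\<close>. Grafting its block \<open>b\<close> onto the iterate gives an admissible
    competitor for the update, and it tends to \<open>y\<close> because \<open>y\<close> agrees with
    \<open>z\<close> off \<open>b\<close>.\<close>
  define w where "w n v = (if blk v = b then y v else x (m n) v)" for n v
  have wlim: "(\<lambda>n. w n v) \<longlonglongrightarrow> y v" if "v \<in> V" for v
    using xm[OF that] y(2)[OF that] by (cases "blk v = b") (auto simp: w_def)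
  have "X b (w n)" for n
    by (rule cong_X[OF b y(1)]) (simp add: w_def)
  then have ineq: "Re (f (x (Suc (m n)))) \<le> Re (f (w n)) + \<kappa> * sqdist V (w n) (x (m n))" for n
    using optimal[of "m n" "w n"] m(3)[of n] by (auto simp: w_def)
  have lim1: "(\<lambda>n. Re (f (x (Suc (m n))))) \<longlonglongrightarrow> Re (f z)"
    by (intro tendsto_intros cpoly_tendsto[OF poly] xSm)
  have lim2: "(\<lambda>n. Re (f (w n)) + \<kappa> * sqdist V (w n) (x (m n))) \<longlonglongrightarrow> Re (f y) + \<kappa> * sqdist V y z"
    by (intro tendsto_intros cpoly_tendsto[OF poly] wlim sqdist_tendsto xm)
  show ?thesis
    using LIMSEQ_le[OF lim1 lim2] ineq by blast
qed

text \<open>Optimality in each block, with a proximal term of second order, makes the derivative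
  along each block component of \<open>y - z\<close> nonnegative. Additivity of the derivative then
  gives the full direction.\<close>

lemma limit_stationary:
  assumes y: "\<And>b. b \<in> B \<Longrightarrow> X b y"
  shows "\<exists>D\<ge>0. ((\<lambda>t. Re (f (\<lambda>v. z v + complex_of_real t * (y v - z v)))) has_real_derivative D) (at 0)"
proof -
  obtain D where D: "\<And>d. ((\<lambda>t. f (\<lambda>v. z v + complex_of_real t * d v)) has_vector_derivative D d) (at 0)"
    and D_add: "\<And>d e. D (\<lambda>v. d v + e v) = D d + D e"
    using cpoly_derivative[OF poly, of z] by blast
  have D': "((\<lambda>t. Re (f (\<lambda>v. z v + complex_of_real t * d v))) has_real_derivative Re (D d)) (at 0)" for d
    using D[of d] by (rule has_field_derivative_Re)
  \<comment> \<open>The direction \<open>y - z\<close> cut down to the blocks in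
    \<open>S\<close>.\<close>
  define part where "part S v = (if blk v \<in> S then y v - z v else 0)" for S v
  have D_block: "0 \<le> Re (D (part {b}))" if b: "b \<in> B" for b
  proof (rule ccontr)
    define q where "q = (\<Sum>v\<in>V. (cmod (part {b} v))\<^sup>2)"
    \<comment> \<open>The proximal objective along block \<open>b\<close>. Its quadratic term has
      derivative zero at zero, so a negative derivative of \<open>f\<close> would push
      \<open>g\<close> below \<open>g 0\<close> for small positive \<open>t\<close>, against the
      block optimality of \<open>z\<close>.\<close>
    define g where "g t = Re (f (\<lambda>v. z v + complex_of_real t * part {b} v)) + \<kappa> * (t\<^sup>2 * q)" for t
    assume "\<not> 0 \<le> Re (D (part {b}))"
    moreover have "(g has_real_derivative Re (D (part {b}))) (at 0)"
    proof -
      have "((\<lambda>t. \<kappa> * (t\<^sup>2 * q)) has_real_derivative 0) (at 0)"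
        by (auto intro!: derivative_eq_intros)
      from DERIV_add[OF D'[of "part {b}"] this] show ?thesis by (simp add: g_def[abs_def])
    qed
    ultimately obtain \<delta> where \<delta>: "0 < \<delta>" "\<And>h. 0 < h \<Longrightarrow> h < \<delta> \<Longrightarrow> g (0 + h) < g 0"
      using DERIV_neg_dec_right[of g _ 0] by (auto simp: not_le)
    \<comment> \<open>Halving gives \<open>t < \<delta>\<close> strictly, and the cap at one keeps
      the point on the segment where convexity gives feasibility.\<close>
    define t where "t = min (\<delta> / 2) 1"
    have t: "0 < t" "t < \<delta>" "t \<le> 1"
      using \<delta>(1) by (auto simp: t_def)
    have "X b (\<lambda>v. z v + complex_of_real t * (y v - z v))"
      using limit_feasible[OF b] y[OF b] t b by (intro convex) auto
    then have X: "X b (\<lambda>v. z v + complex_of_real t * part {b} v)"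
      by (rule cong_X[OF b]) (simp add: part_def)
    have "Re (f z) \<le> Re (f (\<lambda>v. z v + complex_of_real t * part {b} v))
        + \<kappa> * sqdist V (\<lambda>v. z v + complex_of_real t * part {b} v) z"
      by (rule limit_block_optimal[OF b X]) (simp add: part_def)
    also have "sqdist V (\<lambda>v. z v + complex_of_real t * part {b} v) z = t\<^sup>2 * q"
      by (simp add: sqdist_def q_def norm_mult power_mult_distrib sum_distrib_left)
    finally show False
      using \<delta>(2)[OF t(1,2)] by (simp add: g_def)
  qed
  have D_0: "D (\<lambda>v. 0) = 0"
    using D_add[of "\<lambda>v. 0" "\<lambda>v. 0"] by simp
  have D_parts: "D (part S) = (\<Sum>b\<in>S. D (part {b}))" if "finite S" for S
    using that
  proof induction
    case empty
    then show ?case using D_0 by (simp add: part_def[abs_def])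
  next
    case (insert b S)
    have "part (insert b S) = (\<lambda>v. part {b} v + part S v)"
      using insert.hyps by (auto simp: part_def fun_eq_iff)
    then show ?case
      using D_add[of "part {b}" "part S"] insert by simp
  qed
  have "0 \<le> Re (D (part B))"
    unfolding D_parts[OF finite_B] Re_sum by (intro sum_nonneg D_block)
  \<comment> \<open>Every coordinate in \<open>V\<close> belongs to a block in \<open>B\<close>, so
    \<open>part B\<close> agrees there with \<open>y - z\<close>.\<close>
  moreover have "f (\<lambda>v. z v + complex_of_real t * part B v) = f (\<lambda>v. z v + complex_of_real t * (y v - z v))" for t
    using blk by (intro cpoly_cong[OF poly]) (auto simp: part_def)
  ultimately show ?thesis
    using D'[of "part B"] by auto
qed

end

end

section \<open>Quadratic forms\<close>

lemma adjoint_dim [simp]: "dim_row (A\<^sup>H) = dim_col A" "dim_col (A\<^sup>H) = dim_row A"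
  by (auto simp: mat_adjoint_def)

lemma adjoint_carrier [intro, simp]: "A \<in> carrier_mat n m \<Longrightarrow> A\<^sup>H \<in> carrier_mat m n"
  by (metis adjoint_dim carrier_matD carrier_matI)

lemma adjoint_index [simp]:
  fixes A :: "complex mat"
  shows "i < dim_col A \<Longrightarrow> j < dim_row A \<Longrightarrow> A\<^sup>H $$ (i, j) = cnj (A $$ (j, i))"
  by (simp add: mat_adjoint_def mat_of_rows_index)

lemma adjoint_mult:
  fixes A B :: "complex mat"
  assumes "dim_col A = dim_row B"
  shows "(A * B)\<^sup>H = B\<^sup>H * A\<^sup>H"
  by (rule eq_matI) (use assms in \<open>auto simp: scalar_prod_def mult.commute\<close>)

lemma mat_assoc:
  fixes A B C :: "complex mat"
  assumes "dim_col A = dim_row B" "dim_col B = dim_row C"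
  shows "A * B * C = A * (B * C)"
  using assms
  by (intro assoc_mult_mat[of A "dim_row A" "dim_col A" B "dim_col B" C "dim_col C"] carrier_matI) auto

lemma adjoint_adjoint [simp]:
  fixes A :: "complex mat"
  shows "(A\<^sup>H)\<^sup>H = A"
  by (rule eq_matI) auto

text \<open>The Hermitian form of a row vector, with the conjugate on the right factor. This is the
  form that the rows of \<open>X\<close> produce in \<open>X * A * X\<^sup>H\<close>.\<close>

definition quad :: "nat \<Rightarrow> complex mat \<Rightarrow> (nat \<Rightarrow> complex) \<Rightarrow> complex" where
  "quad n A w = (\<Sum>b<n. \<Sum>c<n. w b * A $$ (b, c) * cnj (w c))"

lemma quad_cong: "(\<And>b. b < n \<Longrightarrow> w b = v b) \<Longrightarrow> quad n A w = quad n A v"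
  by (simp add: quad_def)

text \<open>Each diagonal entry is the form at a row of \<open>X\<close>. Both the error and the
  transmit powers reach coordinates through this identity.\<close>

lemma trace_adjoint_form:
  assumes "X \<in> carrier_mat r n" "A \<in> carrier_mat n n"
  shows "trace (X * A * X\<^sup>H) = (\<Sum>a<r. quad n A (\<lambda>b. X $$ (a, b)))"
proof -
  have "(X * A * X\<^sup>H) $$ (a, a) = quad n A (\<lambda>b. X $$ (a, b))" if "a < r" for a
  proof -
    have "(X * A * X\<^sup>H) $$ (a, a) = (\<Sum>c<n. (\<Sum>b<n. X $$ (a, b) * A $$ (b, c)) * cnj (X $$ (a, c)))"
      using assms that by (simp add: scalar_prod_def atLeast0LessThan)
    also have "\<dots> = quad n A (\<lambda>b. X $$ (a, b))"
      unfolding quad_def sum_distrib_right by (rule sum.swap)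
    finally show ?thesis .
  qed
  then show ?thesis
    using assms by (simp add: trace_def)
qed

lemma quad_gram:
  assumes A: "A \<in> carrier_mat n k" and C: "C \<in> carrier_mat k k"
  shows "quad n (A * C * A\<^sup>H) w = quad k C (\<lambda>c. \<Sum>b<n. w b * A $$ (b, c))"
proof -
  \<comment> \<open>As a one-row matrix, \<open>w\<close> can be moved through the product by
    associativity, which turns the form into that of \<open>C\<close> at the row
    \<open>R * A\<close>.\<close>
  define R where "R = mat 1 n (\<lambda>(a, b). w b)"
  have R: "R \<in> carrier_mat 1 n" by (simp add: R_def)
  have "quad n (A * C * A\<^sup>H) w = trace (R * (A * C * A\<^sup>H) * R\<^sup>H)"
    using A C by (subst trace_adjoint_form[OF R]) (auto simp: R_def intro!: quad_cong)
  also have "R * (A * C * A\<^sup>H) * R\<^sup>H = (R * A) * C * (R * A)\<^sup>H"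
    using carrier_matD[OF A] carrier_matD[OF C] carrier_matD[OF R]
    by (simp add: adjoint_mult mat_assoc del: assoc_mult_mat)
  also have "trace \<dots> = quad k C (\<lambda>c. \<Sum>b<n. w b * A $$ (b, c))"
    using A by (subst trace_adjoint_form[OF mult_carrier_mat[OF R A] C])
      (auto simp: R_def scalar_prod_def atLeast0LessThan intro!: quad_cong)
  finally show ?thesis .
qed

lemma quad_add_mat:
  assumes "A \<in> carrier_mat n n" "B \<in> carrier_mat n n"
  shows "quad n (A + B) w = quad n A w + quad n B w"
  using assms by (simp add: quad_def algebra_simps sum.distrib)

text \<open>The exact convexity defect of a quadratic form. For a semidefinite matrix and
  \<open>t\<close> between 0 and 1 the subtracted term has nonnegative real part, which gives both
  the convexity of the power constraint and the midpoint inequality.\<close>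

lemma quad_segment:
  "quad n A (\<lambda>b. v b + complex_of_real t * (w b - v b)) =
     (1 - complex_of_real t) * quad n A v + complex_of_real t * quad n A w
       - complex_of_real (t * (1 - t)) * quad n A (\<lambda>b. v b - w b)"
  unfolding quad_def sum_distrib_left sum.distrib[symmetric] sum_subtractf[symmetric]
  by (intro sum.cong refl) (simp add: algebra_simps)

text \<open>Conjugating the entries reconciles the row form with the column form used to define
  definiteness.\<close>

lemma quad_conjugate_vec:
  assumes "A \<in> carrier_mat n n"
  shows "quad n A w = (A *\<^sub>v vec n (\<lambda>b. cnj (w b))) \<bullet>c vec n (\<lambda>b. cnj (w b))"
proof -
  have "(A *\<^sub>v vec n (\<lambda>b. cnj (w b))) \<bullet>c vec n (\<lambda>b. cnj (w b))
      = (\<Sum>b<n. (\<Sum>c<n. A $$ (b, c) * cnj (w c)) * w b)"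
    using assms by (simp add: scalar_prod_def atLeast0LessThan)
  also have "\<dots> = quad n A w"
    unfolding quad_def sum_distrib_right by (intro sum.cong refl) (simp add: mult_ac)
  finally show ?thesis ..
qed

lemma quad_nonneg: "pos_semidef n A \<Longrightarrow> 0 \<le> Re (quad n A w)"
  by (auto simp: pos_semidef_def hermitian_def quad_conjugate_vec less_eq_complex_def)

lemma quad_pos:
  assumes "pos_def n A" "b < n" "w b \<noteq> 0"
  shows "0 < Re (quad n A w)"
proof -
  have "vec n (\<lambda>b. cnj (w b)) \<noteq> 0\<^sub>v n"
    using assms(2,3) by (metis complex_cnj_zero_iff index_vec index_zero_vec(1))
  then show ?thesis
    using assms(1) by (auto simp: pos_def_def hermitian_def quad_conjugate_vec less_complex_def)
qed

lemma cpoly_quad: "(\<And>b. b < n \<Longrightarrow> cpoly V (\<lambda>x. w x b)) \<Longrightarrow> cpoly V (\<lambda>x. quad n A (w x))"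
  unfolding quad_def by (intro cpoly_intros) auto

lemma quad_scale: "quad n A (\<lambda>b. complex_of_real t * w b) = complex_of_real (t\<^sup>2) * quad n A w"
  unfolding quad_def sum_distrib_left
  by (intro sum.cong refl) (simp add: power2_eq_square algebra_simps)

text \<open>Compactness of the unit sphere: if no constant worked, there would be unit vectors whose
  forms lie below \<open>1 / (k + 1)\<close>, and a limit of a subsequence would be a unit vector
  with nonpositive form.\<close>

lemma pos_def_coercive:
  assumes A: "pos_def n A"
  shows "\<exists>\<mu>>0. \<forall>w. \<mu> * (\<Sum>b<n. (cmod (w b))\<^sup>2) \<le> Re (quad n A w)"
proof (rule ccontr)
  assume contra: "\<not> ?thesis"
  have "\<exists>w. (\<Sum>b<n. (cmod (w b))\<^sup>2) = 1 \<and> Re (quad n A w) < inverse (real (Suc k))" for k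
  proof -
    have "inverse (real (Suc k)) > 0" by simp
    then have "\<not> (\<forall>w. inverse (real (Suc k)) * (\<Sum>b<n. (cmod (w b))\<^sup>2) \<le> Re (quad n A w))"
      using contra by blast
    then obtain w where w: "Re (quad n A w) < inverse (real (Suc k)) * (\<Sum>b<n. (cmod (w b))\<^sup>2)"
      unfolding not_all not_le by blast
    define s where "s = (\<Sum>b<n. (cmod (w b))\<^sup>2)"
    \<comment> \<open>If the norm were zero, both sides of the strict inequality for
      \<open>w\<close> would vanish.\<close>
    have "s \<noteq> 0"
    proof
      assume "s = 0"
      then have "\<forall>b<n. w b = 0"
        by (auto simp: s_def sum_nonneg_eq_0_iff)
      then have "quad n A w = 0" by (simp add: quad_def)
      with w \<open>s = 0\<close> show False by (simp add: s_def)
    qed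
    moreover have "0 \<le> s" by (auto simp: s_def intro: sum_nonneg)
    ultimately have s: "s > 0" by simp
    define v where "v b = complex_of_real (1 / sqrt s) * w b" for b
    have "(\<Sum>b<n. (cmod (v b))\<^sup>2) = (\<Sum>b<n. (cmod (w b))\<^sup>2 / s)"
      using s by (intro sum.cong refl) (simp add: v_def norm_mult norm_divide power_mult_distrib power_divide)
    then have "(\<Sum>b<n. (cmod (v b))\<^sup>2) = 1"
      using s by (simp add: s_def flip: sum_divide_distrib)
    moreover have "Re (quad n A v) = Re (quad n A w) / s"
      using s quad_scale[of n A "1 / sqrt s" w] by (simp add: v_def[abs_def] power_divide)
    ultimately show ?thesis
      using w s by (intro exI[of _ v]) (simp add: pos_divide_less_eq s_def)
  qed
  then have "\<forall>k. \<exists>w. (\<Sum>b<n. (cmod (w b))\<^sup>2) = 1 \<and> Re (quad n A w) < inverse (real (Suc k))"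
    by blast
  from choice[OF this] obtain W where W: "\<And>k. (\<Sum>b<n. (cmod (W k b))\<^sup>2) = 1"
    "\<And>k. Re (quad n A (W k)) < inverse (real (Suc k))"
    by blast
  have bounded: "cmod (W k b) \<le> 1" if "b \<in> {..<n}" for k b
  proof -
    have "(cmod (W k b))\<^sup>2 \<le> (\<Sum>b<n. (cmod (W k b))\<^sup>2)"
      using that by (intro member_le_sum) auto
    then have "(cmod (W k b))\<^sup>2 \<le> 1\<^sup>2"
      using W(1) by simp
    then show ?thesis by (rule power2_le_imp_le) simp
  qed
  obtain r l where r: "strict_mono (r :: nat \<Rightarrow> nat)" "\<And>b. b \<in> {..<n} \<Longrightarrow> (\<lambda>k. W (r k) b) \<longlonglongrightarrow> l b"
    using bounded_coordinates_subseq[of "{..<n}" W "\<lambda>_. 1"] bounded by blast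
  have "(\<lambda>k. \<Sum>b<n. (cmod (W (r k) b))\<^sup>2) \<longlonglongrightarrow> (\<Sum>b<n. (cmod (l b))\<^sup>2)"
    using r(2) by (intro tendsto_intros) auto
  then have "(\<Sum>b<n. (cmod (l b))\<^sup>2) = 1"
    using W(1) LIMSEQ_unique[of "\<lambda>_. 1 :: real"] by simp
  then have "\<exists>b<n. l b \<noteq> 0"
    by (rule contrapos_pp) simp
  then obtain b where "b < n" "l b \<noteq> 0" by blast
  then have "0 < Re (quad n A l)"
    by (rule quad_pos[OF A])
  moreover have "Re (quad n A l) \<le> 0"
  proof (rule LIMSEQ_le)
    have "cpoly {..<n} (quad n A)"
      using cpoly_quad[of n "{..<n}" "\<lambda>x. x"] by (simp add: cpoly_var)
    from cpoly_tendsto[OF this r(2)] show "(\<lambda>k. Re (quad n A (W (r k)))) \<longlonglongrightarrow> Re (quad n A l)"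
      by (intro tendsto_Re)
    show "(\<lambda>k. inverse (real (Suc (r k)))) \<longlonglongrightarrow> 0"
      using LIMSEQ_subseq_LIMSEQ[OF LIMSEQ_inverse_real_of_nat r(1)] by (simp add: o_def)
    show "\<exists>N. \<forall>k\<ge>N. Re (quad n A (W (r k))) \<le> inverse (real (Suc (r k)))"
      using W(2) less_imp_le by blast
  qed
  ultimately show False by simp
qed

section \<open>The mean squared error in coordinates\<close>

text \<open>A coordinate is a block together with a row and a column, so \<open>fst\<close> tells
  which block it belongs to.\<close>

fun entry :: "(nat \<Rightarrow> complex mat) \<Rightarrow> complex mat \<Rightarrow> block \<times> nat \<times> nat \<Rightarrow> complex" where
  "entry F G (G_block, a, c) = G $$ (a, c)"
| "entry F G (F_block i, a, c) = F i $$ (a, c)"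

fun block_rows :: "mse_system \<Rightarrow> block \<Rightarrow> nat" where
  "block_rows p G_block = dim_M p"
| "block_rows p (F_block i) = dim_N p i"

fun block_cols :: "mse_system \<Rightarrow> block \<Rightarrow> nat" where
  "block_cols p G_block = dim_K p"
| "block_cols p (F_block i) = dim_J p i"

definition coords :: "mse_system \<Rightarrow> (block \<times> nat \<times> nat) set" where
  "coords p = (SIGMA b : blocks p. {..<block_rows p b} \<times> {..<block_cols p b})"

definition shaped :: "mse_system \<Rightarrow> (nat \<Rightarrow> complex mat) \<Rightarrow> complex mat \<Rightarrow> bool" where
  "shaped p F G \<longleftrightarrow> (\<forall>i\<in>sensors p. F i \<in> carrier_mat (dim_N p i) (dim_J p i)) \<and>
     G \<in> carrier_mat (dim_M p) (dim_K p)"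

definition signal_entry :: "mse_system \<Rightarrow> (block \<times> nat \<times> nat \<Rightarrow> complex) \<Rightarrow> nat \<Rightarrow> nat \<Rightarrow> complex" where
  "signal_entry p x m k = (\<Sum>i\<in>sensors p. \<Sum>j<dim_J p i. \<Sum>n<dim_N p i.
     chan p i $$ (m, n) * x (F_block i, n, j) * obs p i $$ (j, k))"

text \<open>The entry \<open>(a, k)\<close> of \<open>W = G\<^sup>H * S - I\<close>; the conditional
  is the identity matrix.\<close>

definition error_entry :: "mse_system \<Rightarrow> (block \<times> nat \<times> nat \<Rightarrow> complex) \<Rightarrow> nat \<Rightarrow> nat \<Rightarrow> complex" where
  "error_entry p x a k =
     (\<Sum>m<dim_M p. cnj (x (G_block, m, a)) * signal_entry p x m k) - (if a = k then 1 else 0)"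

text \<open>The entry \<open>(a, j)\<close> of \<open>G\<^sup>H * chan p i * F i\<close>.\<close>

definition noise_entry :: "mse_system \<Rightarrow> (block \<times> nat \<times> nat \<Rightarrow> complex) \<Rightarrow> nat \<Rightarrow> nat \<Rightarrow> nat \<Rightarrow> complex" where
  "noise_entry p x i a j = (\<Sum>n<dim_N p i. \<Sum>m<dim_M p.
     cnj (x (G_block, m, a)) * chan p i $$ (m, n) * x (F_block i, n, j))"

text \<open>The error after completing the square. In this form every summand has nonnegative real
  part for valid data.\<close>

definition mse_poly :: "mse_system \<Rightarrow> (block \<times> nat \<times> nat \<Rightarrow> complex) \<Rightarrow> complex" where
  "mse_poly p x = (\<Sum>a<dim_K p. quad (dim_K p) (cov_src p) (error_entry p x a))
     + (\<Sum>i\<in>sensors p. \<Sum>a<dim_K p. quad (dim_J p i) (cov_obs p i) (noise_entry p x i a))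
     + complex_of_real (noise_var p) *
       (\<Sum>a<dim_K p. \<Sum>m<dim_M p. x (G_block, m, a) * cnj (x (G_block, m, a)))"

definition input_cov :: "mse_system \<Rightarrow> nat \<Rightarrow> complex mat" where
  "input_cov p i = obs p i * cov_src p * (obs p i)\<^sup>H + cov_obs p i"

text \<open>Matrix dimensions are built into the coordinates, so only the power bounds remain as
  constraints and \<open>G\<close> is free.\<close>

fun block_feasible :: "mse_system \<Rightarrow> block \<Rightarrow> (block \<times> nat \<times> nat \<Rightarrow> complex) \<Rightarrow> bool" where
  "block_feasible p G_block x \<longleftrightarrow> True"
| "block_feasible p (F_block i) x \<longleftrightarrow>
     Re (\<Sum>a<dim_N p i. quad (dim_J p i) (input_cov p i) (\<lambda>c. x (F_block i, a, c))) \<le> power p i"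

lemma finite_sensors [simp]: "finite (sensors p)"
  by (simp add: sensors_def)

lemma finite_coords: "finite (coords p)"
  by (simp add: coords_def blocks_def)

lemma cpoly_mse: "cpoly (coords p) (mse_poly p)"
proof -
  have G: "cpoly (coords p) (\<lambda>x. x (G_block, m, a))" if "m < dim_M p" "a < dim_K p" for m a
    using that by (intro cpoly_intros) (simp add: coords_def blocks_def)
  have F: "cpoly (coords p) (\<lambda>x. x (F_block i, n, j))"
    if "i \<in> sensors p" "n < dim_N p i" "j < dim_J p i" for i n j
    using that by (intro cpoly_intros) (auto simp: coords_def blocks_def)
  show ?thesis
    unfolding mse_poly_def error_entry_def noise_entry_def signal_entry_def
    by (intro cpoly_intros cpoly_quad G F) auto
qed

section \<open>Traces and completion of the square\<close>

lemma trace_add: "dim_row A = dim_row B \<Longrightarrow> dim_row B \<le> dim_col B \<Longrightarrow> trace (A + B) = trace A + trace B"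
  by (simp add: trace_def sum.distrib)

lemma trace_diff: "dim_row A = dim_row B \<Longrightarrow> dim_row B \<le> dim_col B \<Longrightarrow> trace (A - B) = trace A - trace B"
  by (simp add: trace_def sum_subtractf)

lemma trace_mat_sum:
  assumes "\<And>i. i \<in> I \<Longrightarrow> A i \<in> carrier_mat n n"
  shows "trace (mat_sum n n A I) = (\<Sum>i\<in>I. trace (A i))"
proof -
  have "trace (mat_sum n n A I) = (\<Sum>a<n. \<Sum>i\<in>I. A i $$ (a, a))"
    by (simp add: trace_def mat_sum_def)
  also have "\<dots> = (\<Sum>i\<in>I. \<Sum>a<n. A i $$ (a, a))" by (rule sum.swap)
  also have "\<dots> = (\<Sum>i\<in>I. trace (A i))"
    by (intro sum.cong refl) (use assms in \<open>auto simp: trace_def\<close>)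
  finally show ?thesis .
qed

text \<open>The order of summation is the one in \<open>signal_entry\<close> and
  \<open>noise_entry\<close>.\<close>

lemma mat_mult3_entry:
  fixes A B C :: "complex mat"
  assumes "A \<in> carrier_mat n m" "B \<in> carrier_mat m k" "C \<in> carrier_mat k l" "a < n" "b < l"
  shows "(A * B * C) $$ (a, b) = (\<Sum>j<k. \<Sum>i<m. A $$ (a, i) * B $$ (i, j) * C $$ (j, b))"
  using assms by (simp add: scalar_prod_def atLeast0LessThan sum_distrib_right del: assoc_mult_mat)

lemma MSE_eq:
  assumes p: "valid_system p" and FG: "shaped p F G"
  shows "MSE p F G = Re (mse_poly p (entry F G))"
proof -
  let ?K = "dim_K p" and ?M = "dim_M p" and ?C = "cov_src p" and ?x = "entry F G"
  define S where "S = signal_mat p F"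
  define W where "W = G\<^sup>H * S - 1\<^sub>m ?K"
  define N where "N i = G\<^sup>H * chan p i * F i" for i
  have C: "?C \<in> carrier_mat ?K ?K"
    using p by (auto simp: valid_system_def pos_semidef_def hermitian_def)
  have G: "G \<in> carrier_mat ?M ?K" and F: "\<And>i. i \<in> sensors p \<Longrightarrow> F i \<in> carrier_mat (dim_N p i) (dim_J p i)"
    using FG by (auto simp: shaped_def)
  have obs: "\<And>i. i \<in> sensors p \<Longrightarrow> obs p i \<in> carrier_mat (dim_J p i) ?K"
    and chan: "\<And>i. i \<in> sensors p \<Longrightarrow> chan p i \<in> carrier_mat ?M (dim_N p i)"
    and cov: "\<And>i. i \<in> sensors p \<Longrightarrow> cov_obs p i \<in> carrier_mat (dim_J p i) (dim_J p i)"
    using p by (auto simp: valid_system_def pos_semidef_def hermitian_def)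
  have S: "S \<in> carrier_mat ?M ?K"
    by (simp add: S_def signal_mat_def mat_sum_def)
  have S_entry: "S $$ (m, k) = signal_entry p ?x m k" if "m < ?M" "k < ?K" for m k
    using that unfolding S_def signal_mat_def mat_sum_def signal_entry_def
    by (auto intro!: sum.cong simp: mat_mult3_entry[OF chan F obs])
  have W: "W \<in> carrier_mat ?K ?K"
    using G S by (auto simp: W_def intro!: minus_carrier_mat)
  have W_entry: "W $$ (a, k) = error_entry p ?x a k" if "a < ?K" "k < ?K" for a k
    using that G S by (auto simp: W_def error_entry_def scalar_prod_def atLeast0LessThan S_entry intro!: sum.cong)
  have N: "N i \<in> carrier_mat ?K (dim_J p i)" if "i \<in> sensors p" for i
    unfolding N_def using mult_carrier_mat[OF mult_carrier_mat[OF adjoint_carrier[OF G] chan[OF that]] F[OF that]] .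
  have N_entry: "N i $$ (a, j) = noise_entry p ?x i a j"
    if "i \<in> sensors p" "a < ?K" "j < dim_J p i" for i a j
    unfolding N_def noise_entry_def
      mat_mult3_entry[OF adjoint_carrier[OF G] chan[OF that(1)] F[OF that(1)] that(2,3)]
    using that G by (intro sum.cong refl) auto
  have signal: "trace (G\<^sup>H * S * ?C * S\<^sup>H * G) - trace (G\<^sup>H * S * ?C) - trace (?C * S\<^sup>H * G) + trace ?C
      = (\<Sum>a<?K. quad ?K ?C (error_entry p ?x a))"
  proof -
    \<comment> \<open>With \<open>W = E - I\<close>, the product \<open>W C W\<^sup>H\<close>
      expands to \<open>E C E\<^sup>H - C E\<^sup>H - E C + C\<close>, whose traces are the four
      signal terms of the error.\<close>
    define E where "E = G\<^sup>H * S"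
    have E: "E \<in> carrier_mat ?K ?K" unfolding E_def using mult_carrier_mat[OF adjoint_carrier[OF G] S] .
    have EH: "E\<^sup>H = S\<^sup>H * G"
      using carrier_matD[OF G] carrier_matD[OF S] by (simp add: E_def adjoint_mult)
    have W_E: "W = E - 1\<^sub>m ?K" by (simp add: W_def E_def)
    have WH: "W\<^sup>H = E\<^sup>H - 1\<^sub>m ?K"
      by (rule eq_matI) (use E in \<open>auto simp: W_E\<close>)
    have "W * ?C * W\<^sup>H = (E * ?C - ?C) * (E\<^sup>H - 1\<^sub>m ?K)"
      unfolding WH using E C by (simp add: W_E minus_mult_distrib_mat[of _ ?K ?K])
    also have "\<dots> = (E * ?C - ?C) * E\<^sup>H - (E * ?C - ?C)"
      using E C by (subst mult_minus_distrib_mat[of _ ?K ?K]) auto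
    also have "\<dots> = E * ?C * E\<^sup>H - ?C * E\<^sup>H - (E * ?C - ?C)"
      using E C by (subst minus_mult_distrib_mat[of _ ?K ?K]) auto
    finally have "trace (W * ?C * W\<^sup>H) = trace (E * ?C * E\<^sup>H) - trace (?C * E\<^sup>H) - (trace (E * ?C) - trace ?C)"
      using carrier_matD[OF E] carrier_matD[OF C] by (simp add: trace_diff del: assoc_mult_mat)
    moreover have "E * ?C * E\<^sup>H = G\<^sup>H * S * ?C * S\<^sup>H * G"
      using carrier_matD[OF G] carrier_matD[OF S] carrier_matD[OF C] unfolding EH by (simp add: E_def mat_assoc del: assoc_mult_mat)
    moreover have "?C * E\<^sup>H = ?C * S\<^sup>H * G"
      using carrier_matD[OF G] carrier_matD[OF S] carrier_matD[OF C] unfolding EH by (simp add: mat_assoc del: assoc_mult_mat)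
    moreover have "trace (W * ?C * W\<^sup>H) = (\<Sum>a<?K. quad ?K ?C (error_entry p ?x a))"
      unfolding trace_adjoint_form[OF W C] by (intro sum.cong refl quad_cong) (auto simp: W_entry)
    ultimately show ?thesis by (simp add: E_def)
  qed
  have noise: "trace (G\<^sup>H * chan p i * F i * cov_obs p i * (F i)\<^sup>H * (chan p i)\<^sup>H * G)
      = (\<Sum>a<?K. quad (dim_J p i) (cov_obs p i) (noise_entry p ?x i a))"
    if i: "i \<in> sensors p" for i
  proof -
    note car = carrier_matD[OF G] carrier_matD[OF F[OF i]] carrier_matD[OF chan[OF i]] carrier_matD[OF cov[OF i]]
    have "(N i)\<^sup>H = (F i)\<^sup>H * ((chan p i)\<^sup>H * G)"
      using car by (simp add: N_def adjoint_mult)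
    then have "N i * cov_obs p i * (N i)\<^sup>H
        = G\<^sup>H * chan p i * F i * cov_obs p i * (F i)\<^sup>H * (chan p i)\<^sup>H * G"
      using car by (simp add: N_def mat_assoc del: assoc_mult_mat)
    then show ?thesis
      using trace_adjoint_form[OF N[OF i] cov[OF i]] N_entry[OF i]
      by (auto intro!: sum.cong quad_cong)
  qed
  have amplify: "trace (complex_of_real (noise_var p) \<cdot>\<^sub>m (G\<^sup>H * G)) = complex_of_real (noise_var p) *
       (\<Sum>a<?K. \<Sum>m<?M. ?x (G_block, m, a) * cnj (?x (G_block, m, a)))"
    using G by (simp add: trace_def scalar_prod_def atLeast0LessThan sum_distrib_left mult.commute)
  \<comment> \<open>Naming the noise sum keeps it intact while the outer trace is split.\<close>
  define Q where "Q = mat_sum ?K ?K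
    (\<lambda>i. G\<^sup>H * chan p i * F i * cov_obs p i * (F i)\<^sup>H * (chan p i)\<^sup>H * G) (sensors p)"
  have Q: "Q \<in> carrier_mat ?K ?K" by (simp add: Q_def mat_sum_def)
  have trace_Q: "trace Q = (\<Sum>i\<in>sensors p. \<Sum>a<?K. quad (dim_J p i) (cov_obs p i) (noise_entry p ?x i a))"
    unfolding Q_def using G F chan cov by (subst trace_mat_sum) (auto simp: noise)
  have "MSE p F G = Re (trace (G\<^sup>H * S * ?C * S\<^sup>H * G - G\<^sup>H * S * ?C - ?C * S\<^sup>H * G
      + Q + complex_of_real (noise_var p) \<cdot>\<^sub>m (G\<^sup>H * G) + ?C))"
    by (simp add: MSE_def Let_def S_def Q_def)
  also have "trace (G\<^sup>H * S * ?C * S\<^sup>H * G - G\<^sup>H * S * ?C - ?C * S\<^sup>H * G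
      + Q + complex_of_real (noise_var p) \<cdot>\<^sub>m (G\<^sup>H * G) + ?C) =
     (trace (G\<^sup>H * S * ?C * S\<^sup>H * G) - trace (G\<^sup>H * S * ?C) - trace (?C * S\<^sup>H * G) + trace ?C)
      + trace Q + trace (complex_of_real (noise_var p) \<cdot>\<^sub>m (G\<^sup>H * G))"
    using carrier_matD[OF G] carrier_matD[OF S] carrier_matD[OF C] carrier_matD[OF Q]
    by (simp add: trace_add trace_diff del: assoc_mult_mat)
  also have "\<dots> = mse_poly p ?x"
    by (simp only: signal trace_Q amplify mse_poly_def)
  finally show ?thesis .
qed

section \<open>Passing between coordinates and matrices\<close>

lemma coords_cases:
  assumes "v \<in> coords p"
  obtains (G) a c where "v = (G_block, a, c)" "a < dim_M p" "c < dim_K p"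
  | (F) i a c where "v = (F_block i, a, c)" "i \<in> sensors p" "a < dim_N p i" "c < dim_J p i"
  using assms by (auto simp: coords_def blocks_def)

lemma mat_sum_cong:
  "I = J \<Longrightarrow> (\<And>i. i \<in> J \<Longrightarrow> A i = B i) \<Longrightarrow> mat_sum n m A I = mat_sum n m B J"
  by (simp add: mat_sum_def)

text \<open>Block updates leave the family unspecified outside \<open>sensors p\<close>, so the
  error must not depend on those values.\<close>

lemma MSE_cong:
  assumes "\<And>j. j \<in> sensors p \<Longrightarrow> F' j = F j"
  shows "MSE p F' G = MSE p F G"
  unfolding MSE_def signal_mat_def using assms by (simp cong: mat_sum_cong)

text \<open>Together with \<open>mat_G\<close> this inverts \<open>entry\<close> on the coordinates
  in range.\<close>

definition mats_F :: "mse_system \<Rightarrow> (block \<times> nat \<times> nat \<Rightarrow> complex) \<Rightarrow> nat \<Rightarrow> complex mat" where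
  "mats_F p x i = mat (dim_N p i) (dim_J p i) (\<lambda>(a, c). x (F_block i, a, c))"

definition mat_G :: "mse_system \<Rightarrow> (block \<times> nat \<times> nat \<Rightarrow> complex) \<Rightarrow> complex mat" where
  "mat_G p x = mat (dim_M p) (dim_K p) (\<lambda>(a, c). x (G_block, a, c))"

lemma mats_carrier [simp]:
  "mats_F p x i \<in> carrier_mat (dim_N p i) (dim_J p i)" "mat_G p x \<in> carrier_mat (dim_M p) (dim_K p)"
  by (simp_all add: mats_F_def mat_G_def)

section \<open>The power constraints\<close>

lemma feasible_F_iff:
  assumes p: "valid_system p" and i: "i \<in> sensors p" and F: "F i \<in> carrier_mat (dim_N p i) (dim_J p i)"
  shows "feasible_F p i (F i) \<longleftrightarrow> block_feasible p (F_block i) (entry F G)"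
proof -
  have "input_cov p i \<in> carrier_mat (dim_J p i) (dim_J p i)"
    using p i by (auto simp: input_cov_def valid_system_def pos_semidef_def hermitian_def)
  then show ?thesis
    using F trace_adjoint_form[OF F] by (simp add: feasible_F_def flip: input_cov_def)
qed

lemma quad_input_cov:
  assumes p: "valid_system p" and i: "i \<in> sensors p"
  shows "quad (dim_J p i) (input_cov p i) w =
    quad (dim_J p i) (obs p i * cov_src p * (obs p i)\<^sup>H) w + quad (dim_J p i) (cov_obs p i) w"
    and "0 \<le> Re (quad (dim_J p i) (obs p i * cov_src p * (obs p i)\<^sup>H) w)"
    and "0 \<le> Re (quad (dim_J p i) (cov_obs p i) w)"
proof -
  have obs: "obs p i \<in> carrier_mat (dim_J p i) (dim_K p)" and psd: "pos_semidef (dim_J p i) (cov_obs p i)"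
    and src: "pos_semidef (dim_K p) (cov_src p)"
    using p i by (auto simp: valid_system_def)
  then have car: "cov_obs p i \<in> carrier_mat (dim_J p i) (dim_J p i)" "cov_src p \<in> carrier_mat (dim_K p) (dim_K p)"
    by (auto simp: pos_semidef_def hermitian_def)
  have "obs p i * cov_src p * (obs p i)\<^sup>H \<in> carrier_mat (dim_J p i) (dim_J p i)"
    using mult_carrier_mat[OF mult_carrier_mat[OF obs car(2)] adjoint_carrier[OF obs]] .
  from quad_add_mat[OF this car(1)]
  show "quad (dim_J p i) (input_cov p i) w =
    quad (dim_J p i) (obs p i * cov_src p * (obs p i)\<^sup>H) w + quad (dim_J p i) (cov_obs p i) w"
    by (simp add: input_cov_def)
  show "0 \<le> Re (quad (dim_J p i) (obs p i * cov_src p * (obs p i)\<^sup>H) w)"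
    unfolding quad_gram[OF obs car(2)] by (rule quad_nonneg[OF src])
  show "0 \<le> Re (quad (dim_J p i) (cov_obs p i) w)"
    by (rule quad_nonneg[OF psd])
qed

text \<open>The definite one of the two summands gives the constant, and the other only adds a
  nonnegative form.\<close>

lemma input_cov_coercive:
  assumes p: "valid_system p" and i: "i \<in> sensors p"
    and pd: "pos_def (dim_J p i) (obs p i * cov_src p * (obs p i)\<^sup>H) \<or> pos_def (dim_J p i) (cov_obs p i)"
  shows "\<exists>\<mu>>0. \<forall>w. \<mu> * (\<Sum>b<dim_J p i. (cmod (w b))\<^sup>2) \<le> Re (quad (dim_J p i) (input_cov p i) w)"
proof -
  obtain A where A: "pos_def (dim_J p i) A" "A = obs p i * cov_src p * (obs p i)\<^sup>H \<or> A = cov_obs p i"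
    using pd by blast
  have le: "Re (quad (dim_J p i) A w) \<le> Re (quad (dim_J p i) (input_cov p i) w)" for w
    using A(2) quad_input_cov[OF p i, of w] by auto
  obtain \<mu> where "\<mu> > 0" "\<And>w. \<mu> * (\<Sum>b<dim_J p i. (cmod (w b))\<^sup>2) \<le> Re (quad (dim_J p i) A w)"
    using pos_def_coercive[OF A(1)] by blast
  then show ?thesis
    using le by (meson order_trans)
qed

lemma block_feasible_convex:
  assumes p: "valid_system p" and b: "b \<in> blocks p"
    and x: "block_feasible p b x" and y: "block_feasible p b y" and t: "0 \<le> t" "t \<le> 1"
  shows "block_feasible p b (\<lambda>v. x v + complex_of_real t * (y v - x v))"
proof (cases b)
  case (F_block i)
  then have i: "i \<in> sensors p" using b by (auto simp: blocks_def)
  define q where "q z = Re (\<Sum>a<dim_N p i. quad (dim_J p i) (input_cov p i) (\<lambda>c. z (F_block i, a, c)))" for z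
  \<comment> \<open>The constraint is a sublevel set of a semidefinite form, and
    \<open>quad_segment\<close> is summed over the rows.\<close>
  have "q (\<lambda>v. x v + complex_of_real t * (y v - x v)) =
      (1 - t) * q x + t * q y - t * (1 - t) * q (\<lambda>v. x v - y v)"
    unfolding q_def Re_sum sum_distrib_left sum.distrib[symmetric] sum_subtractf[symmetric]
    by (intro sum.cong refl) (simp add: quad_segment)
  also have "\<dots> \<le> (1 - t) * q x + t * q y"
    using t quad_input_cov[OF p i] by (auto simp: q_def intro!: mult_nonneg_nonneg sum_nonneg add_nonneg_nonneg)
  also have "\<dots> \<le> (1 - t) * power p i + t * power p i"
    using t x y F_block by (intro add_mono mult_left_mono) (auto simp: q_def)
  also have "\<dots> = power p i" by (simp add: algebra_simps)
  finally show ?thesis using F_block by (simp add: q_def)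
qed simp

lemma block_feasible_closed:
  assumes b: "b \<in> blocks p" and y: "\<And>n. block_feasible p b (y n)"
    and lim: "\<And>v. v \<in> coords p \<Longrightarrow> fst v = b \<Longrightarrow> (\<lambda>n. y n v) \<longlonglongrightarrow> z v"
  shows "block_feasible p b z"
proof (cases b)
  case (F_block i)
  then have i: "i \<in> sensors p" using b by (auto simp: blocks_def)
  \<comment> \<open>Convergence is given only in block \<open>b\<close>, so the power is viewed as a
    polynomial in those coordinates.\<close>
  define V where "V = {v \<in> coords p. fst v = b}"
  define q where "q z = (\<Sum>a<dim_N p i. quad (dim_J p i) (input_cov p i) (\<lambda>c. z (F_block i, a, c)))" for z
  have "cpoly V q"
    unfolding q_def using i F_block
    by (intro cpoly_intros cpoly_quad) (auto simp: V_def coords_def blocks_def)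
  then have "(\<lambda>n. q (y n)) \<longlonglongrightarrow> q z"
    by (rule cpoly_tendsto) (use lim in \<open>auto simp: V_def\<close>)
  then have "(\<lambda>n. Re (q (y n))) \<longlonglongrightarrow> Re (q z)"
    by (rule tendsto_Re)
  then have "Re (q z) \<le> power p i"
    using y F_block by (intro LIMSEQ_le_const2[where X = "\<lambda>n. Re (q (y n))"]) (auto simp: q_def)
  then show ?thesis using F_block by (simp add: q_def)
qed simp

section \<open>Squared distances and convexity estimates\<close>

lemma sqdist_block:
  assumes b: "b \<in> blocks p" and eq: "\<And>v. v \<in> coords p \<Longrightarrow> fst v \<noteq> b \<Longrightarrow> x v = y v"
  shows "sqdist (coords p) x y =
    (\<Sum>a<block_rows p b. \<Sum>c<block_cols p b. (cmod (x (b, a, c) - y (b, a, c)))\<^sup>2)"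
proof -
  have "sqdist (coords p) x y =
      (\<Sum>v\<in>Pair b ` ({..<block_rows p b} \<times> {..<block_cols p b}). (cmod (x v - y v))\<^sup>2)"
    unfolding sqdist_def
  proof (intro sum.mono_neutral_right finite_coords ballI)
    fix v assume "v \<in> coords p - Pair b ` ({..<block_rows p b} \<times> {..<block_cols p b})"
    then have "v \<in> coords p" "fst v \<noteq> b" by (auto simp: coords_def)
    then show "(cmod (x v - y v))\<^sup>2 = 0" using eq by simp
  qed (use b in \<open>auto simp: coords_def\<close>)
  also have "\<dots> = (\<Sum>(a, c)\<in>{..<block_rows p b} \<times> {..<block_cols p b}. (cmod (x (b, a, c) - y (b, a, c)))\<^sup>2)"
    by (subst sum.reindex) (auto simp: inj_on_def intro!: sum.cong)
  finally show ?thesis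
    by (simp add: sum.cartesian_product)
qed

lemma vec_norm2_vectorize_diff:
  assumes "A \<in> carrier_mat n m" "B \<in> carrier_mat n m"
  shows "(vec_norm2 (vectorize A - vectorize B))\<^sup>2 = (\<Sum>a<n. \<Sum>c<m. (cmod (A $$ (a, c) - B $$ (a, c)))\<^sup>2)"
proof -
  have "(vec_norm2 (vectorize A - vectorize B))\<^sup>2 =
      (\<Sum>k<n * m. (cmod (A $$ (k mod n, k div n) - B $$ (k mod n, k div n)))\<^sup>2)"
    using assms by (simp add: vec_norm2_def vectorize_def sum_nonneg)
  also have "\<dots> = (\<Sum>(a, c)\<in>{..<n} \<times> {..<m}. (cmod (A $$ (a, c) - B $$ (a, c)))\<^sup>2)"
  \<comment> \<open>Column stacking places the entry \<open>(a, c)\<close> at position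
    \<open>a + c * n\<close>.\<close>
  proof (rule sum.reindex_bij_witness[where i = "\<lambda>(a, c). a + c * n" and j = "\<lambda>k. (k mod n, k div n)"])
    fix k assume "k \<in> {..<n * m}"
    then have k: "k < m * n" "0 < n" by (auto simp: mult.commute intro: Nat.gr0I)
    then show "(k mod n, k div n) \<in> {..<n} \<times> {..<m}"
      by (auto intro: less_mult_imp_div_less)
  next
    fix z assume "z \<in> {..<n} \<times> {..<m}"
    then obtain a c where z: "z = (a, c)" "a < n" "c < m" by auto
    have "a + c * n < (c + 1) * n" using z by simp
    also have "\<dots> \<le> m * n" using z by (intro mult_le_mono1) simp
    finally show "(case z of (a, c) \<Rightarrow> a + c * n) \<in> {..<n * m}"
      using z by (simp add: mult.commute)
    show "((case z of (a, c) \<Rightarrow> a + c * n) mod n, (case z of (a, c) \<Rightarrow> a + c * n) div n) = z"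
      using z by simp
  qed auto
  finally show ?thesis by (simp add: sum.cartesian_product)
qed

text \<open>The two covariance terms are nonnegative. What remains bounds \<open>G\<close> by the
  error and shows the error to be nonnegative.\<close>

lemma mse_poly_ge:
  assumes p: "valid_system p"
  shows "noise_var p * (\<Sum>a<dim_K p. \<Sum>m<dim_M p. (cmod (x (G_block, m, a)))\<^sup>2) \<le> Re (mse_poly p x)"
proof -
  have "0 \<le> (\<Sum>a<dim_K p. Re (quad (dim_K p) (cov_src p) (error_entry p x a)))"
    using p by (intro sum_nonneg quad_nonneg) (simp add: valid_system_def)
  moreover have "0 \<le> (\<Sum>i\<in>sensors p. \<Sum>a<dim_K p. Re (quad (dim_J p i) (cov_obs p i) (noise_entry p x i a)))"
    using p by (intro sum_nonneg quad_nonneg) (simp add: valid_system_def)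
  ultimately show ?thesis
    by (simp add: mse_poly_def complex_norm_square[symmetric] flip: of_real_sum of_real_power)
qed

text \<open>For fixed \<open>F\<close> the error and noise entries are affine in the conjugate of
  \<open>G\<close> over the reals, so the covariance terms are midpoint convex. The noise variance
  term supplies the strong convexity.\<close>

lemma mse_poly_midpoint:
  assumes p: "valid_system p" and eq: "\<And>v. fst v \<noteq> G_block \<Longrightarrow> x v = y v"
  shows "Re (mse_poly p (\<lambda>v. x v + complex_of_real (1/2) * (y v - x v)))
    + noise_var p / 4 * (\<Sum>a<dim_K p. \<Sum>m<dim_M p. (cmod (x (G_block, m, a) - y (G_block, m, a)))\<^sup>2)
    \<le> (Re (mse_poly p x) + Re (mse_poly p y)) / 2"
proof -
  define z where "z v = x v + complex_of_real (1/2) * (y v - x v)" for v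
  have F: "y (F_block i, n, j) = x (F_block i, n, j)" "z (F_block i, n, j) = x (F_block i, n, j)" for i n j
    using eq[of "(F_block i, n, j)"] by (auto simp: z_def)
  have sig: "signal_entry p y = signal_entry p x" "signal_entry p z = signal_entry p x"
    by (auto simp: fun_eq_iff signal_entry_def F)
  have err: "error_entry p z a = (\<lambda>k. error_entry p x a k + complex_of_real (1/2) * (error_entry p y a k - error_entry p x a k))" for a
  proof
    fix k
    have "(\<Sum>m<dim_M p. cnj (z (G_block, m, a)) * signal_entry p x m k) =
       (\<Sum>m<dim_M p. cnj (x (G_block, m, a)) * signal_entry p x m k)
       + complex_of_real (1/2) * ((\<Sum>m<dim_M p. cnj (y (G_block, m, a)) * signal_entry p x m k)
         - (\<Sum>m<dim_M p. cnj (x (G_block, m, a)) * signal_entry p x m k))"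
      unfolding sum_distrib_left sum.distrib[symmetric] sum_subtractf[symmetric]
      by (intro sum.cong refl) (simp add: z_def algebra_simps)
    then show "error_entry p z a k = error_entry p x a k + complex_of_real (1/2) * (error_entry p y a k - error_entry p x a k)"
      by (simp add: error_entry_def sig)
  qed
  have noi: "noise_entry p z i a = (\<lambda>j. noise_entry p x i a j + complex_of_real (1/2) * (noise_entry p y i a j - noise_entry p x i a j))" for i a
    unfolding fun_eq_iff noise_entry_def F sum_distrib_left sum.distrib[symmetric] sum_subtractf[symmetric]
    by (intro allI sum.cong refl) (simp add: z_def algebra_simps)
  have half: "Re (quad n A (\<lambda>b. v b + complex_of_real (1/2) * (w b - v b))) \<le> (Re (quad n A v) + Re (quad n A w)) / 2"
    if "pos_semidef n A" for n A v w
    using quad_nonneg[OF that, of "\<lambda>b. v b - w b"] unfolding quad_segment by (simp add: field_simps)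
  have C: "pos_semidef (dim_K p) (cov_src p)"
    and S: "\<And>i. i \<in> sensors p \<Longrightarrow> pos_semidef (dim_J p i) (cov_obs p i)"
    using p by (auto simp: valid_system_def)
  have 1: "(\<Sum>a<dim_K p. Re (quad (dim_K p) (cov_src p) (error_entry p z a))) \<le>
    ((\<Sum>a<dim_K p. Re (quad (dim_K p) (cov_src p) (error_entry p x a)))
      + (\<Sum>a<dim_K p. Re (quad (dim_K p) (cov_src p) (error_entry p y a)))) / 2"
    unfolding sum.distrib[symmetric] sum_divide_distrib err by (intro sum_mono half C)
  have 2: "(\<Sum>i\<in>sensors p. \<Sum>a<dim_K p. Re (quad (dim_J p i) (cov_obs p i) (noise_entry p z i a))) \<le>
    ((\<Sum>i\<in>sensors p. \<Sum>a<dim_K p. Re (quad (dim_J p i) (cov_obs p i) (noise_entry p x i a)))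
     + (\<Sum>i\<in>sensors p. \<Sum>a<dim_K p. Re (quad (dim_J p i) (cov_obs p i) (noise_entry p y i a)))) / 2"
    unfolding sum.distrib[symmetric] sum_divide_distrib noi by (intro sum_mono half S)
  define N where "N x = (\<Sum>a<dim_K p. \<Sum>m<dim_M p. (cmod (x (G_block, m, a)))\<^sup>2)" for x :: "block \<times> nat \<times> nat \<Rightarrow> complex"
  \<comment> \<open>The parallelogram identity, source of the factor one quarter.\<close>
  have par: "(cmod (v + complex_of_real (1/2) * (w - v)))\<^sup>2 = ((cmod v)\<^sup>2 + (cmod w)\<^sup>2) / 2 - (cmod (v - w))\<^sup>2 / 4" for v w
    unfolding cmod_power2 by (simp add: power2_eq_square field_simps)
  have 3: "N z = (N x + N y) / 2 - N (\<lambda>v. x v - y v) / 4"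
    unfolding N_def z_def par by (simp add: sum.distrib sum_subtractf sum_divide_distrib add_divide_distrib)
  have mse: "Re (mse_poly p w) = (\<Sum>a<dim_K p. Re (quad (dim_K p) (cov_src p) (error_entry p w a)))
     + (\<Sum>i\<in>sensors p. \<Sum>a<dim_K p. Re (quad (dim_J p i) (cov_obs p i) (noise_entry p w i a)))
     + noise_var p * N w" for w
    by (simp add: mse_poly_def N_def complex_norm_square[symmetric] flip: of_real_sum of_real_power)
  have "Re (mse_poly p z) + noise_var p / 4 * N (\<lambda>v. x v - y v) \<le> (Re (mse_poly p x) + Re (mse_poly p y)) / 2"
    unfolding mse using 1 2 unfolding 3 by (simp add: field_simps)
  then show ?thesis
    by (simp add: N_def z_def[abs_def])
qed

section \<open>Convergence of the algorithm\<close>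

locale mse_run =
  fixes p :: mse_system and \<kappa> :: real and u :: "nat \<Rightarrow> block"
    and F :: "nat \<Rightarrow> nat \<Rightarrow> complex mat" and G :: "nat \<Rightarrow> complex mat"
  assumes valid: "valid_system p"
    and definite: "\<forall>i\<in>sensors p. pos_def (dim_J p i) (obs p i * cov_src p * (obs p i)\<^sup>H)
                      \<or> pos_def (dim_J p i) (cov_obs p i)"
    and \<kappa>: "\<kappa> > 0"
    and cyclic: "essentially_cyclic p u"
    and run: "bcd_run p \<kappa> u F G"
begin

abbreviation (input) iter :: "nat \<Rightarrow> block \<times> nat \<times> nat \<Rightarrow> complex" where
  "iter n \<equiv> entry (F n) (G n)"

section \<open>Updates and feasibility of the iterates\<close>

lemma noise_var_pos: "0 < noise_var p"
  using valid by (simp add: valid_system_def)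

lemma update: "block_update p \<kappa> (u n) (F n) (G n) (F (Suc n)) (G (Suc n))"
  using run by (simp add: bcd_run_def)

lemma u_block: "u n \<in> blocks p"
  using cyclic by (simp add: essentially_cyclic_def)

lemma F_update:
  assumes "u n = F_block i"
  shows "i \<in> sensors p" "G (Suc n) = G n" "\<And>j. j \<in> sensors p \<Longrightarrow> j \<noteq> i \<Longrightarrow> F (Suc n) j = F n j"
    "feasible_F p i (F (Suc n) i)"
    "\<And>Y. feasible_F p i Y \<Longrightarrow>
      proximal_objective p \<kappa> (F n) (G n) i (F (Suc n) i) \<le> proximal_objective p \<kappa> (F n) (G n) i Y"
  using update[of n] u_block[of n] assms by (auto simp: is_arg_min_def not_less blocks_def)

lemma G_update:
  assumes "u n = G_block"
  shows "\<And>j. j \<in> sensors p \<Longrightarrow> F (Suc n) j = F n j" "G (Suc n) \<in> carrier_mat (dim_M p) (dim_K p)"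
    "\<And>Y. Y \<in> carrier_mat (dim_M p) (dim_K p) \<Longrightarrow> MSE p (F n) (G (Suc n)) \<le> MSE p (F n) Y"
  using update[of n] assms by (auto simp: is_arg_min_def not_less)

lemma run_feasible: "feasible p (F n) (G n)"
proof (induction n)
  case 0
  then show ?case using run by (simp add: bcd_run_def)
next
  case (Suc n)
  show ?case
  proof (cases "u n")
    case (F_block i)
    have "feasible_F p j (F (Suc n) j)" if "j \<in> sensors p" for j
      using F_update(3,4)[OF F_block] Suc that by (cases "j = i") (auto simp: feasible_def)
    then show ?thesis using Suc F_update(2)[OF F_block] by (simp add: feasible_def)
  next
    case G_block
    then show ?thesis using Suc G_update[OF G_block] by (simp add: feasible_def)
  qed
qed

lemma feasible_shaped: "feasible p F' G' \<Longrightarrow> shaped p F' G'"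
  by (simp add: feasible_def shaped_def feasible_F_def)

lemma feasible_iff:
  "shaped p F' G' \<Longrightarrow> feasible p F' G' \<longleftrightarrow> (\<forall>b\<in>blocks p. block_feasible p b (entry F' G'))"
  by (auto simp: feasible_def shaped_def blocks_def feasible_F_iff[OF valid, of _ F' G']
      simp del: block_feasible.simps(2))

lemma run_shaped: "shaped p (F n) (G n)"
  by (rule feasible_shaped[OF run_feasible])

lemma MSE_iter: "MSE p (F n) (G n) = Re (mse_poly p (iter n))"
  by (rule MSE_eq[OF valid run_shaped])

lemma stay:
  assumes "v \<in> coords p" "fst v \<noteq> u n"
  shows "iter (Suc n) v = iter n v"
  using assms(1)
proof (cases rule: coords_cases)
  case (G a c)
  then obtain i where "u n = F_block i" using assms(2) by (cases "u n") auto
  then show ?thesis using G F_update(2) by simp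
next
  case (F i a c)
  then show ?thesis using assms(2) F_update(3)[of n] G_update(1)[of n] by (cases "u n") auto
qed

lemma sqdist_F_block:
  assumes i: "i \<in> sensors p" and X: "X \<in> carrier_mat (dim_N p i) (dim_J p i)"
    and Y: "Y \<in> carrier_mat (dim_N p i) (dim_J p i)"
    and eq: "\<And>v. v \<in> coords p \<Longrightarrow> fst v \<noteq> F_block i \<Longrightarrow> x v = y v"
    and x: "\<And>a c. a < dim_N p i \<Longrightarrow> c < dim_J p i \<Longrightarrow> x (F_block i, a, c) = X $$ (a, c)"
    and y: "\<And>a c. a < dim_N p i \<Longrightarrow> c < dim_J p i \<Longrightarrow> y (F_block i, a, c) = Y $$ (a, c)"
  shows "(vec_norm2 (vectorize X - vectorize Y))\<^sup>2 = sqdist (coords p) x y"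
  using sqdist_block[of "F_block i" p x y] vec_norm2_vectorize_diff[OF X Y] i eq x y
  by (simp add: blocks_def)

section \<open>Sufficient decrease and optimality of the block updates\<close>

lemma F_update_value:
  assumes ui: "u n = F_block i"
  shows "proximal_objective p \<kappa> (F n) (G n) i (F (Suc n) i) =
    Re (mse_poly p (iter (Suc n))) + \<kappa> * sqdist (coords p) (iter (Suc n)) (iter n)"
proof -
  note upd = F_update[OF ui]
  \<comment> \<open>The two families may differ outside \<open>sensors p\<close>, where the error
    does not look.\<close>
  have "MSE p ((F n)(i := F (Suc n) i)) (G n) = MSE p (F (Suc n)) (G (Suc n))"
    unfolding upd(2) by (rule MSE_cong) (use upd(3) in auto)
  moreover have "(vec_norm2 (vectorize (F (Suc n) i) - vectorize (F n i)))\<^sup>2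
      = sqdist (coords p) (iter (Suc n)) (iter n)"
    using upd(1) run_shaped stay ui by (intro sqdist_F_block[of i]) (auto simp: shaped_def)
  ultimately show ?thesis
    by (simp add: proximal_objective_def MSE_iter)
qed

text \<open>The old value of the block is feasible and its proximal term is zero, so it serves as
  the competitor.\<close>

lemma descent_F:
  assumes ui: "u n = F_block i"
  shows "Re (mse_poly p (iter (Suc n))) + \<kappa> * sqdist (coords p) (iter (Suc n)) (iter n)
    \<le> Re (mse_poly p (iter n))"
proof -
  have "feasible_F p i (F n i)"
    using run_feasible F_update(1)[OF ui] by (simp add: feasible_def)
  from F_update(5)[OF ui this] have "proximal_objective p \<kappa> (F n) (G n) i (F (Suc n) i)
      \<le> proximal_objective p \<kappa> (F n) (G n) i (F n i)" .
  also have "\<dots> = MSE p (F n) (G n)"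
    by (simp add: proximal_objective_def vec_norm2_def)
  finally show ?thesis
    by (simp add: F_update_value[OF ui] MSE_iter)
qed

text \<open>Compare the minimizer with the midpoint of the old and the new \<open>G\<close>, using strong convexity.\<close>

lemma descent_G:
  assumes uG: "u n = G_block"
  shows "Re (mse_poly p (iter (Suc n))) + noise_var p / 2 * sqdist (coords p) (iter (Suc n)) (iter n)
    \<le> Re (mse_poly p (iter n))"
proof -
  note upd = G_update[OF uG]
  \<comment> \<open>Since \<open>F (Suc n)\<close> may differ from \<open>F n\<close> outside
    \<open>sensors p\<close>, the new point is replaced by one that shares every coordinate off the
    block of \<open>G\<close> with the old point, as the midpoint inequality demands.\<close>
  define y where "y = entry (F n) (G (Suc n))"
  define z where "z v = iter n v + complex_of_real (1/2) * (y v - iter n v)" for v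
  define d where "d = sqdist (coords p) (iter (Suc n)) (iter n)"
  define e where "e = noise_var p / 4 * d"
  have y: "iter (Suc n) v = y v" if "v \<in> coords p" for v
    using that upd(1) by (cases rule: coords_cases) (auto simp: y_def)
  then have y_val: "mse_poly p (iter (Suc n)) = mse_poly p y"
    by (intro cpoly_cong[OF cpoly_mse])
  have fst_eq: "iter n v = y v" if "fst v \<noteq> G_block" for v
    using that by (cases v; cases "fst v") (auto simp: y_def)
  have "shaped p (F n) (G (Suc n))"
    using run_shaped[of n] upd(2) by (simp add: shaped_def)
  then have "Re (mse_poly p y) = MSE p (F n) (G (Suc n))"
    by (simp add: y_def MSE_eq[OF valid])
  also have "\<dots> \<le> MSE p (F n) (mat_G p z)"
    by (rule upd(3)) simp
  also have "\<dots> = Re (mse_poly p (entry (F n) (mat_G p z)))"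
    using run_shaped[of n] by (intro MSE_eq[OF valid]) (simp add: shaped_def)
  also have "mse_poly p (entry (F n) (mat_G p z)) = mse_poly p z"
  proof (rule cpoly_cong[OF cpoly_mse])
    fix v assume "v \<in> coords p"
    then show "entry (F n) (mat_G p z) v = z v"
      by (cases rule: coords_cases) (auto simp: mat_G_def z_def y_def)
  qed
  finally have min: "Re (mse_poly p y) \<le> Re (mse_poly p z)" .
  have "d = (\<Sum>m<dim_M p. \<Sum>a<dim_K p. (cmod (iter n (G_block, m, a) - y (G_block, m, a)))\<^sup>2)"
    unfolding d_def using stay[of _ n] uG
    by (subst sqdist_block[of G_block]) (auto simp: blocks_def y_def norm_minus_commute)
  also have "\<dots> = (\<Sum>a<dim_K p. \<Sum>m<dim_M p. (cmod (iter n (G_block, m, a) - y (G_block, m, a)))\<^sup>2)"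
    by (rule sum.swap)
  finally have "Re (mse_poly p z) + e \<le> (Re (mse_poly p (iter n)) + Re (mse_poly p y)) / 2"
    using mse_poly_midpoint[OF valid, of "iter n" y] fst_eq by (simp add: z_def[abs_def] e_def)
  \<comment> \<open>Minimality puts the value at \<open>y\<close> below the midpoint value
    \<open>z\<close>; doubling and cancelling one copy leaves \<open>2 * e\<close>, which is the
    claimed half of the noise variance times \<open>d\<close>.\<close>
  then have "Re (mse_poly p y) + 2 * e \<le> Re (mse_poly p (iter n))"
    using min by (simp add: field_simps)
  then show ?thesis
    by (simp add: y_val e_def mult.commute flip: d_def)
qed

text \<open>The smaller of the two rates serves every block.\<close>

lemma descent:
  "Re (mse_poly p (iter (Suc n))) + min \<kappa> (noise_var p / 2) * sqdist (coords p) (iter (Suc n)) (iter n)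
    \<le> Re (mse_poly p (iter n))"
proof -
  have "0 \<le> sqdist (coords p) (iter (Suc n)) (iter n)"
    by (auto simp: sqdist_def intro: sum_nonneg)
  then have le: "min \<kappa> (noise_var p / 2) * sqdist (coords p) (iter (Suc n)) (iter n)
      \<le> c * sqdist (coords p) (iter (Suc n)) (iter n)" if "c = \<kappa> \<or> c = noise_var p / 2" for c
    using that by (intro mult_right_mono) auto
  show ?thesis
    using descent_F[of n] descent_G[of n] le[of \<kappa>] le[of "noise_var p / 2"] by (cases "u n") force+
qed

lemma optimal:
  assumes y: "block_feasible p (u n) y" and eq: "\<And>v. v \<in> coords p \<Longrightarrow> fst v \<noteq> u n \<Longrightarrow> y v = iter n v"
  shows "Re (mse_poly p (iter (Suc n))) \<le> Re (mse_poly p y) + \<kappa> * sqdist (coords p) y (iter n)"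
proof (cases "u n")
  case (F_block i)
  note upd = F_update[OF F_block]
  let ?Y = "mats_F p y i"
  have y_entry: "y v = entry ((F n)(i := ?Y)) (G n) v" if "v \<in> coords p" for v
    using that eq[OF that] F_block by (cases rule: coords_cases) (auto simp: mats_F_def)
  have sh: "shaped p ((F n)(i := ?Y)) (G n)"
    using run_shaped[of n] by (simp add: shaped_def)
  \<comment> \<open>Closedness with a constant sequence transfers feasibility from \<open>y\<close>
    to a point with the same coordinates.\<close>
  have "block_feasible p (F_block i) (entry ((F n)(i := ?Y)) (G n))"
    by (rule block_feasible_closed[where y = "\<lambda>_. y"])
      (use y F_block u_block[of n] y_entry in auto)
  then have "feasible_F p i ?Y"
    using feasible_F_iff[OF valid upd(1), of "(F n)(i := ?Y)" "G n"] by simp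
  have "0 \<le> sqdist (coords p) (iter (Suc n)) (iter n)"
    by (auto simp: sqdist_def intro: sum_nonneg)
  then have "Re (mse_poly p (iter (Suc n))) \<le> proximal_objective p \<kappa> (F n) (G n) i (F (Suc n) i)"
    using \<kappa> by (simp add: F_update_value[OF F_block])
  also have "\<dots> \<le> proximal_objective p \<kappa> (F n) (G n) i ?Y"
    by (rule upd(5)) fact
  also have "\<dots> = Re (mse_poly p (entry ((F n)(i := ?Y)) (G n))) + \<kappa> * (vec_norm2 (vectorize ?Y - vectorize (F n i)))\<^sup>2"
    by (simp add: proximal_objective_def MSE_eq[OF valid sh])
  also have "mse_poly p (entry ((F n)(i := ?Y)) (G n)) = mse_poly p y"
    by (rule cpoly_cong[OF cpoly_mse]) (simp add: y_entry)
  also have "(vec_norm2 (vectorize ?Y - vectorize (F n i)))\<^sup>2 = sqdist (coords p) y (iter n)"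
    using upd(1) run_shaped eq F_block by (intro sqdist_F_block[of i]) (auto simp: shaped_def mats_F_def)
  finally show ?thesis .
next
  case G_block
  note upd = G_update[OF G_block]
  have sh: "shaped p (F n) (mat_G p y)" "shaped p (F n) (G (Suc n))"
    using run_shaped[of n] upd(2) by (simp_all add: shaped_def)
  have y_entry: "entry (F n) (mat_G p y) v = y v" if "v \<in> coords p" for v
    using that eq[OF that] G_block by (cases rule: coords_cases) (auto simp: mat_G_def)
  have "Re (mse_poly p (iter (Suc n))) = MSE p (F n) (G (Suc n))"
    unfolding MSE_iter[symmetric] by (rule MSE_cong) (simp add: upd(1))
  also have "\<dots> \<le> MSE p (F n) (mat_G p y)"
    by (rule upd(3)) simp
  also have "\<dots> = Re (mse_poly p (entry (F n) (mat_G p y)))"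
    by (rule MSE_eq[OF valid sh(1)])
  also have "mse_poly p (entry (F n) (mat_G p y)) = mse_poly p y"
    by (rule cpoly_cong[OF cpoly_mse]) (simp add: y_entry)
  also have "Re (mse_poly p y) \<le> Re (mse_poly p y) + \<kappa> * sqdist (coords p) y (iter n)"
    using \<kappa> by (auto simp: sqdist_def intro!: mult_nonneg_nonneg sum_nonneg)
  finally show ?thesis .
qed

section \<open>Boundedness of the iterates\<close>

lemma mse_nonneg: "0 \<le> Re (mse_poly p x)"
proof -
  have "0 \<le> noise_var p * (\<Sum>a<dim_K p. \<Sum>m<dim_M p. (cmod (x (G_block, m, a)))\<^sup>2)"
    using noise_var_pos by (intro mult_nonneg_nonneg sum_nonneg) auto
  then show ?thesis using mse_poly_ge[OF valid, of x] by linarith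
qed

lemma mse_le_initial: "Re (mse_poly p (iter n)) \<le> Re (mse_poly p (iter 0))"
proof (induction n)
  case (Suc n)
  have "0 \<le> min \<kappa> (noise_var p / 2) * sqdist (coords p) (iter (Suc n)) (iter n)"
    using \<kappa> noise_var_pos by (auto simp: sqdist_def intro!: mult_nonneg_nonneg sum_nonneg)
  then show ?case using descent[of n] Suc by linarith
qed simp

text \<open>Entries of \<open>G\<close> are controlled by the initial error divided by the noise
  variance, entries of \<open>F i\<close> by the power budget divided by the coercivity constant of
  \<open>input_cov p i\<close>.\<close>

lemma bounded:
  assumes "v \<in> coords p"
  shows "\<exists>R. \<forall>n. cmod (iter n v) \<le> R"
  using assms
proof (cases rule: coords_cases)
  case (G m a)
  define R where "R = Re (mse_poly p (iter 0)) / noise_var p"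
  have "cmod (iter n v) \<le> sqrt R" for n
  proof (rule real_le_rsqrt)
    have "(cmod (iter n v))\<^sup>2 \<le> (\<Sum>m<dim_M p. (cmod (iter n (G_block, m, a)))\<^sup>2)"
      using G by (subst G(1), intro member_le_sum[where f = "\<lambda>m. (cmod (iter n (G_block, m, a)))\<^sup>2"]) auto
    also have "\<dots> \<le> (\<Sum>a<dim_K p. \<Sum>m<dim_M p. (cmod (iter n (G_block, m, a)))\<^sup>2)"
      using G by (intro member_le_sum[where f = "\<lambda>a. \<Sum>m<dim_M p. (cmod (iter n (G_block, m, a)))\<^sup>2"] sum_nonneg) auto
    finally have "noise_var p * (cmod (iter n v))\<^sup>2 \<le> Re (mse_poly p (iter n))"
      using mse_poly_ge[OF valid, of "iter n"] noise_var_pos by (meson mult_left_mono less_imp_le order_trans)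
    then show "(cmod (iter n v))\<^sup>2 \<le> R"
      using mse_le_initial[of n] noise_var_pos by (simp add: R_def field_simps)
  qed
  then show ?thesis by blast
next
  case (F i a c)
  let ?q = "\<lambda>x a. Re (quad (dim_J p i) (input_cov p i) (\<lambda>c. x (F_block i, a, c)))"
  obtain \<mu> where \<mu>: "\<mu> > 0" "\<And>w. \<mu> * (\<Sum>b<dim_J p i. (cmod (w b))\<^sup>2) \<le> Re (quad (dim_J p i) (input_cov p i) w)"
    using input_cov_coercive[OF valid F(2)] definite F(2) by blast
  have "cmod (iter n v) \<le> sqrt (power p i / \<mu>)" for n
  proof (rule real_le_rsqrt)
    have "(cmod (iter n v))\<^sup>2 \<le> (\<Sum>c<dim_J p i. (cmod (iter n (F_block i, a, c)))\<^sup>2)"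
      using F by (subst F(1), intro member_le_sum[where f = "\<lambda>c. (cmod (iter n (F_block i, a, c)))\<^sup>2"]) auto
    then have "\<mu> * (cmod (iter n v))\<^sup>2 \<le> \<mu> * (\<Sum>c<dim_J p i. (cmod (iter n (F_block i, a, c)))\<^sup>2)"
      using \<mu>(1) by simp
    also have "\<dots> \<le> ?q (iter n) a" by (rule \<mu>(2))
    also have "\<dots> \<le> (\<Sum>a<dim_N p i. ?q (iter n) a)"
      using F quad_input_cov[OF valid F(2)] by (intro member_le_sum) auto
    also have "\<dots> \<le> power p i"
      using run_feasible[of n] feasible_iff[OF run_shaped, of n] F(2) by (auto simp: blocks_def simp flip: Re_sum)
    finally show "(cmod (iter n v))\<^sup>2 \<le> power p i / \<mu>"
      using \<mu>(1) by (simp add: field_simps)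
  qed
  then show ?thesis by blast
qed

text \<open>The matrix algorithm is an instance of the abstract scheme, with \<open>T\<close> the
  window length from essential cyclicity.\<close>

lemma is_block_descent:
  "\<exists>T. block_descent (coords p) fst (blocks p) (mse_poly p) (block_feasible p) \<kappa> (min \<kappa> (noise_var p / 2)) u iter T"
proof -
  obtain T where T: "\<And>n b. b \<in> blocks p \<Longrightarrow> \<exists>m\<in>{n..<n + T}. u m = b"
    using cyclic unfolding essentially_cyclic_def by blast
  have "block_descent (coords p) fst (blocks p) (mse_poly p) (block_feasible p) \<kappa> (min \<kappa> (noise_var p / 2)) u iter T"
  proof
    show "\<exists>m\<ge>n. m < n + T \<and> u m = b" if "b \<in> blocks p" for n b
      using T[OF that, of n] by auto
    show "block_feasible p b (iter n)" if "b \<in> blocks p" for n b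
      using run_feasible feasible_iff[OF run_shaped] that by blast
    show "finite (blocks p)" by (simp add: blocks_def)
    show "fst ` coords p \<subseteq> blocks p" by (auto simp: coords_def)
    show "0 < min \<kappa> (noise_var p / 2)" using \<kappa> noise_var_pos by simp
  qed (use finite_coords cpoly_mse mse_nonneg block_feasible_closed block_feasible_convex[OF valid]
      descent optimal bounded in blast)+
  then show ?thesis by blast
qed

section \<open>Limit points and stationarity\<close>

lemma mat_tendsto_entries:
  assumes "\<forall>i\<in>sensors p. mat_tendsto (dim_N p i) (dim_J p i) (\<lambda>n. F (Suc (r n)) i) (F' i)"
    and "mat_tendsto (dim_M p) (dim_K p) (\<lambda>n. G (Suc (r n))) G'" and "v \<in> coords p"
  shows "(\<lambda>n. iter (Suc (r n)) v) \<longlonglongrightarrow> entry F' G' v"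
  using assms(3) by (cases rule: coords_cases) (use assms(1,2) in \<open>auto simp: mat_tendsto_def\<close>)

text \<open>Holds for every real \<open>t\<close>, since it relies on matrix shapes and not on
  feasibility. This matters because the derivative in \<open>stationary_point\<close> is
  two-sided.\<close>

lemma MSE_segment:
  assumes sh: "shaped p F' G'" "shaped p F'' G''"
  shows "MSE p (\<lambda>i. F' i + complex_of_real t \<cdot>\<^sub>m (F'' i - F' i)) (G' + complex_of_real t \<cdot>\<^sub>m (G'' - G')) =
    Re (mse_poly p (\<lambda>v. entry F' G' v + complex_of_real t * (entry F'' G'' v - entry F' G' v)))"
proof -
  let ?F = "\<lambda>i. F' i + complex_of_real t \<cdot>\<^sub>m (F'' i - F' i)" and ?G = "G' + complex_of_real t \<cdot>\<^sub>m (G'' - G')"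
  have "shaped p ?F ?G"
    using sh by (auto simp: shaped_def intro!: add_carrier_mat smult_carrier_mat minus_carrier_mat)
  then have "MSE p ?F ?G = Re (mse_poly p (entry ?F ?G))"
    by (rule MSE_eq[OF valid])
  also have "mse_poly p (entry ?F ?G) =
      mse_poly p (\<lambda>v. entry F' G' v + complex_of_real t * (entry F'' G'' v - entry F' G' v))"
  proof (rule cpoly_cong[OF cpoly_mse])
    fix v assume "v \<in> coords p"
    then show "entry ?F ?G v = entry F' G' v + complex_of_real t * (entry F'' G'' v - entry F' G' v)"
      by (cases rule: coords_cases) (use sh in \<open>auto simp: shaped_def\<close>)
  qed
  finally show ?thesis .
qed

lemma convergence:
  shows "decseq (\<lambda>n. MSE p (F (Suc n)) (G (Suc n)))"
    and "\<exists>F' G'. limit_point p (\<lambda>n. F (Suc n)) (\<lambda>n. G (Suc n)) F' G'"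
    and "limit_point p (\<lambda>n. F (Suc n)) (\<lambda>n. G (Suc n)) F' G' \<Longrightarrow> stationary_point p F' G'"
proof -
  obtain T where "block_descent (coords p) fst (blocks p) (mse_poly p) (block_feasible p) \<kappa>
      (min \<kappa> (noise_var p / 2)) u iter T"
    using is_block_descent by blast
  then interpret block_descent "coords p" fst "blocks p" "mse_poly p" "block_feasible p" \<kappa>
    "min \<kappa> (noise_var p / 2)" u iter T .
  show "decseq (\<lambda>n. MSE p (F (Suc n)) (G (Suc n)))"
    unfolding MSE_iter using decseq_values by (auto simp: decseq_Suc_iff)
  obtain r l where r: "strict_mono (r :: nat \<Rightarrow> nat)" "\<And>v. v \<in> coords p \<Longrightarrow> (\<lambda>n. iter (Suc (r n)) v) \<longlonglongrightarrow> l v"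
    using limit_exists by blast
  have "limit_point p (\<lambda>n. F (Suc n)) (\<lambda>n. G (Suc n)) (mats_F p l) (mat_G p l)"
    unfolding limit_point_def mat_tendsto_def
  proof (intro exI[of _ r] conjI ballI allI impI)
    fix i a c assume "i \<in> sensors p" "a < dim_N p i" "c < dim_J p i"
    then show "(\<lambda>n. F (Suc (r n)) i $$ (a, c)) \<longlonglongrightarrow> mats_F p l i $$ (a, c)"
      using r(2)[of "(F_block i, a, c)"] by (simp add: mats_F_def coords_def blocks_def)
  next
    fix a c assume "a < dim_M p" "c < dim_K p"
    then show "(\<lambda>n. G (Suc (r n)) $$ (a, c)) \<longlonglongrightarrow> mat_G p l $$ (a, c)"
      using r(2)[of "(G_block, a, c)"] by (simp add: mat_G_def coords_def blocks_def)
  qed (use r(1) in auto)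
  then show "\<exists>F' G'. limit_point p (\<lambda>n. F (Suc n)) (\<lambda>n. G (Suc n)) F' G'" by blast
  assume "limit_point p (\<lambda>n. F (Suc n)) (\<lambda>n. G (Suc n)) F' G'"
  then obtain r where r: "strict_mono r"
    and lim: "\<forall>i\<in>sensors p. mat_tendsto (dim_N p i) (dim_J p i) (\<lambda>n. F (Suc (r n)) i) (F' i)"
      "mat_tendsto (dim_M p) (dim_K p) (\<lambda>n. G (Suc (r n))) G'"
    by (auto simp: limit_point_def)
  have sh: "shaped p F' G'"
    using lim by (auto simp: shaped_def mat_tendsto_def)
  \<comment> \<open>A subsequence of the shifted sequence is a subsequence of the full sequence of
    iterates, to which the abstract result applies.\<close>
  have r': "strict_mono (\<lambda>n. Suc (r n))"
    using r by (auto simp: strict_mono_def)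
  note limit = mat_tendsto_entries[OF lim]
  show "stationary_point p F' G'"
    unfolding stationary_point_def
  proof (intro conjI allI impI)
    show "feasible p F' G'"
      unfolding feasible_iff[OF sh] using limit_feasible[OF r' limit] by blast
  next
    fix F'' G'' assume feas: "feasible p F'' G''"
    then have "block_feasible p b (entry F'' G'')" if "b \<in> blocks p" for b
      using feasible_iff[OF feasible_shaped] that by blast
    from limit_stationary[OF r' limit this]
    show "\<exists>D\<ge>0. ((\<lambda>t. MSE p (\<lambda>i. F' i + complex_of_real t \<cdot>\<^sub>m (F'' i - F' i))
        (G' + complex_of_real t \<cdot>\<^sub>m (G'' - G'))) has_real_derivative D) (at 0)"
      unfolding MSE_segment[OF sh feasible_shaped[OF feas]] by blast
  qed
qed

end

theorem theorem5:
  fixes p :: mse_system and \<kappa> :: real and u :: "nat \<Rightarrow> block"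
    and F :: "nat \<Rightarrow> nat \<Rightarrow> complex mat" and G :: "nat \<Rightarrow> complex mat"
  assumes "valid_system p"
    and "\<forall>i\<in>sensors p. pos_def (dim_J p i) (obs p i * cov_src p * (obs p i)\<^sup>H)
                      \<or> pos_def (dim_J p i) (cov_obs p i)"
    and "\<kappa> > 0"
    and "essentially_cyclic p u"
    and "bcd_run p \<kappa> u F G"
  shows "decseq (\<lambda>n. MSE p (F (Suc n)) (G (Suc n)))
    \<and> (\<exists>F' G'. limit_point p (\<lambda>n. F (Suc n)) (\<lambda>n. G (Suc n)) F' G')
    \<and> (\<forall>F' G'. limit_point p (\<lambda>n. F (Suc n)) (\<lambda>n. G (Suc n)) F' G' \<longrightarrow> stationary_point p F' G')"
proof -
  interpret mse_run p \<kappa> u F G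
    using assms by unfold_locales
  show ?thesis using convergence by blast
qed

end
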